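(* Let $I$ be a non-empty set and let $E$ be a linear subspace of $\mathbb{R}^I$ with an absolute norm such that $\operatorname{span}\{e_i : i\in I\}$ is dense in $E$. If $(X_i)_{i\in I}$ is a family of Banach spaces which are weakly almost square (WASQ), then the absolute sum $X=[\oplus_{i\in I}X_i]_E$ is WASQ.
   Context: All Banach spaces are real. $S_X$ and $B_X$ denote the unit sphere and closed unit ball of $X$. A Banach space $X$ is weakly almost square (WASQ) if for every $x\in S_X$ there exists a sequence $(y_n)\subset B_X$ such that $\|x\pm y_n\|\to 1$, $\|y_n\|\to 1$ and $y_n\to 0$ weakly. Let $I$ be a non-empty set and $E$ a linear subspace of $\mathbb{R}^I$. An absolute norm on $E$ is a complete norm $\|\cdot\|_E$ on $E$ such that: (i) given $(a_i)_{i\in I},(b_i)_{i\in I}\in\mathbb{R}^I$ with $|b_i|\le|a_i|$ for every $i\in I$, if $(a_i)_{i\in I}\in E$ then $(b_i)_{i\in I}\in E$ and $\|(b_i)_{i\in I}\|_E\le\|(a_i)_{i\in I}\|_E$; (ii) for every $i\in I$ the function $e_i:I\to\mathbb{R}$, $e_i(j)=\delta_{ij}$, belongs to $E$ and $\|e_i\|_E=1$. The absolute sum of a family $(X_i)_{i\in I}$ of Banach spaces with respect to $E$ is $[\oplus_{i\in I}X_i]_E=\{(x_i)_{i\in I}\in\prod_{i\in I}X_i : (\|x_i\|)_{i\in I}\in E\}$, a Banach space with norm $\|(x_i)_{i\in I}\|=\|(\|x_i\|)_{i\in I}\|_E$. *)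

theory Defs
  imports "HOL-Algebra.Algebraic_Closure_Type" "HOL-Analysis.Analysis"
begin

text \<open>Frees the name \<open>X\<close>, which HOL-Algebra uses for the polynomial variable.\<close>

no_notation var (\<open>X\<index>\<close>)

text \<open>
  Families of arbitrary Banach spaces, and their absolute sums, are not available at the level of
  type classes, since the members of a family may be different spaces. Normed spaces are therefore
  structures with an explicit carrier: modules of HOL-Algebra over the ring of real numbers,
  equipped with a norm. The fields \<open>mult\<close> and \<open>one\<close>, which every \<open>module\<close> record inherits from
  \<open>ring\<close>, have no meaning in a vector space and are never used.
\<close>

abbreviation real_ring :: "real ring" where
  "real_ring \<equiv> ring_of_type_algebra"

record 'a normed_module = "(real, 'a) module" +
  vnorm :: "'a \<Rightarrow> real" (\<open>\<parallel>_\<parallel>\<index>\<close>)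


section \<open>Normed spaces and Banach spaces\<close>

locale real_normed_space = Module.module real_ring X
  for X :: "('a, 'm) normed_module_scheme" (structure) +
  assumes vnorm_nonneg: "x \<in> carrier X \<Longrightarrow> 0 \<le> \<parallel>x\<parallel>"
    and vnorm_eq_0_iff: "x \<in> carrier X \<Longrightarrow> \<parallel>x\<parallel> = 0 \<longleftrightarrow> x = \<zero>"
    and vnorm_smult: "x \<in> carrier X \<Longrightarrow> \<parallel>c \<odot> x\<parallel> = \<bar>c\<bar> * \<parallel>x\<parallel>"
    and vnorm_triangle: "x \<in> carrier X \<Longrightarrow> y \<in> carrier X \<Longrightarrow> \<parallel>x \<oplus> y\<parallel> \<le> \<parallel>x\<parallel> + \<parallel>y\<parallel>"

text \<open>
  Locale \<open>Metric_space\<close> asks for nonnegativity and symmetry on the whole type, hence the value 0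
  outside the carrier.
\<close>

definition norm_dist :: "('a, 'm) normed_module_scheme \<Rightarrow> 'a \<Rightarrow> 'a \<Rightarrow> real" where
  "norm_dist X x y =
     (if x \<in> carrier X \<and> y \<in> carrier X then \<parallel>x \<ominus>\<^bsub>X\<^esub> y\<parallel>\<^bsub>X\<^esub> else 0)"

definition norm_topology :: "('a, 'm) normed_module_scheme \<Rightarrow> 'a topology" where
  "norm_topology X = Metric_space.mtopology (carrier X) (norm_dist X)"

definition banach_space :: "('a, 'm) normed_module_scheme \<Rightarrow> bool" where
  "banach_space X \<longleftrightarrow>
     real_normed_space X \<and> Metric_space.mcomplete (carrier X) (norm_dist X)"

definition unit_sphere :: "('a, 'm) normed_module_scheme \<Rightarrow> 'a set" where
  "unit_sphere X = {x \<in> carrier X. \<parallel>x\<parallel>\<^bsub>X\<^esub> = 1}"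

definition unit_ball :: "('a, 'm) normed_module_scheme \<Rightarrow> 'a set" where
  "unit_ball X = {x \<in> carrier X. \<parallel>x\<parallel>\<^bsub>X\<^esub> \<le> 1}"

definition linear_span :: "('a, 'm) normed_module_scheme \<Rightarrow> 'a set \<Rightarrow> 'a set" where
  "linear_span X S = (\<lambda>H. submodule H real_ring X) hull S"

text \<open>Continuous linear functionals; their values outside the carrier are irrelevant.\<close>

definition dual :: "('a, 'm) normed_module_scheme \<Rightarrow> ('a \<Rightarrow> real) set" where
  "dual X = {f.
     (\<forall>x\<in>carrier X. \<forall>y\<in>carrier X. f (x \<oplus>\<^bsub>X\<^esub> y) = f x + f y) \<and>
     (\<forall>c. \<forall>x\<in>carrier X. f (c \<odot>\<^bsub>X\<^esub> x) = c * f x) \<and>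
     (\<exists>C. \<forall>x\<in>carrier X. \<bar>f x\<bar> \<le> C * \<parallel>x\<parallel>\<^bsub>X\<^esub>)}"

definition weakly_convergent_to ::
  "('a, 'm) normed_module_scheme \<Rightarrow> (nat \<Rightarrow> 'a) \<Rightarrow> 'a \<Rightarrow> bool" where
  "weakly_convergent_to X y l \<longleftrightarrow>
     range y \<subseteq> carrier X \<and> l \<in> carrier X \<and> (\<forall>f\<in>dual X. (\<lambda>n. f (y n)) \<longlonglongrightarrow> f l)"


section \<open>Weakly almost square Banach spaces\<close>

definition WASQ :: "('a, 'm) normed_module_scheme \<Rightarrow> bool" where
  "WASQ X \<longleftrightarrow> banach_space X \<and>
     (\<forall>x\<in>unit_sphere X. \<exists>y :: nat \<Rightarrow> 'a.
        (\<forall>n. y n \<in> unit_ball X) \<and>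
        (\<lambda>n. \<parallel>x \<oplus>\<^bsub>X\<^esub> y n\<parallel>\<^bsub>X\<^esub>) \<longlonglongrightarrow> 1 \<and>
        (\<lambda>n. \<parallel>x \<ominus>\<^bsub>X\<^esub> y n\<parallel>\<^bsub>X\<^esub>) \<longlonglongrightarrow> 1 \<and>
        (\<lambda>n. \<parallel>y n\<parallel>\<^bsub>X\<^esub>) \<longlonglongrightarrow> 1 \<and>
        weakly_convergent_to X y \<zero>\<^bsub>X\<^esub>)"


section \<open>Absolute norms and absolute sums\<close>

text \<open>
  Families indexed by the set \<open>I\<close> are extensional functions. In particular the vector space of all
  real-valued functions on \<open>I\<close> has carrier \<open>I \<rightarrow>\<^sub>E UNIV\<close>.
\<close>

definition real_functions :: "'i set \<Rightarrow> (real, 'i \<Rightarrow> real) module" where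
  "real_functions I =
     \<lparr>carrier = I \<rightarrow>\<^sub>E UNIV, monoid.mult = undefined, one = undefined,
      ring.zero = (\<lambda>i\<in>I. 0), add = (\<lambda>a b. \<lambda>i\<in>I. a i + b i),
      module.smult = (\<lambda>c a. \<lambda>i\<in>I. c * a i)\<rparr>"

text \<open>The subspace \<open>E\<close> of \<open>real_functions I\<close> with the norm \<open>N\<close>.\<close>

definition function_space ::
  "'i set \<Rightarrow> ('i \<Rightarrow> real) set \<Rightarrow> (('i \<Rightarrow> real) \<Rightarrow> real) \<Rightarrow> ('i \<Rightarrow> real) normed_module" where
  "function_space I E N =
     \<lparr>carrier = E, monoid.mult = undefined, one = undefined,
      ring.zero = \<zero>\<^bsub>real_functions I\<^esub>, add = add (real_functions I),
      module.smult = module.smult (real_functions I), vnorm = N\<rparr>"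

definition unit_vector :: "'i set \<Rightarrow> 'i \<Rightarrow> 'i \<Rightarrow> real" where
  "unit_vector I i = (\<lambda>j\<in>I. if j = i then 1 else 0)"

definition absolute_norm ::
  "'i set \<Rightarrow> ('i \<Rightarrow> real) set \<Rightarrow> (('i \<Rightarrow> real) \<Rightarrow> real) \<Rightarrow> bool" where
  "absolute_norm I E N \<longleftrightarrow>
     banach_space (function_space I E N) \<and>
     (\<forall>a \<in> I \<rightarrow>\<^sub>E UNIV. \<forall>b \<in> I \<rightarrow>\<^sub>E UNIV.
        (\<forall>i\<in>I. \<bar>b i\<bar> \<le> \<bar>a i\<bar>) \<longrightarrow> a \<in> E \<longrightarrow> b \<in> E \<and> N b \<le> N a) \<and>
     (\<forall>i\<in>I. unit_vector I i \<in> E \<and> N (unit_vector I i) = 1)"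

definition norm_family ::
  "'i set \<Rightarrow> ('i \<Rightarrow> ('a, 'm) normed_module_scheme) \<Rightarrow> ('i \<Rightarrow> 'a) \<Rightarrow> 'i \<Rightarrow> real" where
  "norm_family I X x = (\<lambda>i\<in>I. \<parallel>x i\<parallel>\<^bsub>X i\<^esub>)"

definition absolute_sum ::
  "'i set \<Rightarrow> ('i \<Rightarrow> real) set \<Rightarrow> (('i \<Rightarrow> real) \<Rightarrow> real) \<Rightarrow>
     ('i \<Rightarrow> ('a, 'm) normed_module_scheme) \<Rightarrow> ('i \<Rightarrow> 'a) normed_module" where
  "absolute_sum I E N X =
     \<lparr>carrier = {x \<in> \<Pi>\<^sub>E i\<in>I. carrier (X i). norm_family I X x \<in> E},
      monoid.mult = undefined, one = undefined,
      ring.zero = (\<lambda>i\<in>I. \<zero>\<^bsub>X i\<^esub>),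
      add = (\<lambda>x y. \<lambda>i\<in>I. x i \<oplus>\<^bsub>X i\<^esub> y i),
      module.smult = (\<lambda>c x. \<lambda>i\<in>I. c \<odot>\<^bsub>X i\<^esub> x i),
      vnorm = (\<lambda>x. N (norm_family I X x))\<rparr>"

end

theory Submission
  imports Defs
begin

text \<open>
  For a unit vector \<open>x\<close> of the sum, scale the sequences given by the WASQ property of the summands
  and let \<open>y\<^sub>n\<close> have the coordinates \<open>\<parallel>x\<^sub>i\<parallel> z\<^sub>i\<^sub>n\<close>; all coordinates are used at once, so no diagonal
  argument over finite sets of indices is needed. Density of the span of the unit vectors gives a
  dominated convergence theorem in \<open>E\<close>, because a dominating element has small tails. As
  \<open>\<parallel>x\<^sub>i \<plusminus> y\<^sub>n\<^sub>i\<parallel> \<le> 2\<parallel>x\<^sub>i\<parallel>\<close>, it yields the limits of the norms. A functional on the sum restricts to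
  functionals on finitely many summands up to a uniformly small tail, whence \<open>y\<^sub>n\<close> is weakly null.
\<close>

text \<open>The summands reach their limits at unrelated speeds, so coordinatewise convergence by
  itself says nothing about \<open>N\<close>. In an infinite sup-norm space every tail of the
  constant function 1 over a finite set keeps norm 1, and coordinatewise null functions dominated by
  it need not be null in norm. Every sequence in the argument is therefore kept below a multiple of
  one fixed element of \<open>E\<close>, the norm family of \<open>x\<close>; scaling by the
  coordinate norms serves this purpose, and a zero coordinate receives the zero sequence.

  The conclusion also contains completeness of the sum. A Cauchy sequence there converges in each
  coordinate, but that the coordinatewise limit belongs to the sum and is a norm limit has to come
  from \<open>E\<close>. Passing to norm families reduces this to completeness of \<open>E\<close>,
  but yields only convergence of norms. Convergence of the vectors follows by applying the reduction
  to differences with a fixed member of the sequence.\<close>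

lemma real_ring_simps [simp]:
  "carrier real_ring = UNIV" "\<zero>\<^bsub>real_ring\<^esub> = 0" "\<one>\<^bsub>real_ring\<^esub> = 1"
  "a \<oplus>\<^bsub>real_ring\<^esub> b = a + b" "a \<otimes>\<^bsub>real_ring\<^esub> b = a * b"
  by (simp_all add: ring_of_type_algebra_def)

lemma cring_real_ring: "cring real_ring"
  by (rule cring_from_type_algebra)

lemma a_inv_real_ring [simp]: "\<ominus>\<^bsub>real_ring\<^esub> c = - c"
proof -
  interpret cring real_ring by (rule cring_real_ring)
  show ?thesis by (rule minus_equality) auto
qed

section \<open>Normed spaces\<close>

context real_normed_space
begin

text \<open>In HOL-Algebra the additive inverse is a definite description, which is awkward to
  evaluate in a concrete carrier. Scaling by -1 is explicit, and through it differences in function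
  spaces and in absolute sums become coordinatewise.\<close>

lemma a_inv_eq_smult: "x \<in> carrier X \<Longrightarrow> \<ominus> x = (- 1) \<odot> x"
  using smult_l_minus[of 1 x] smult_one[of x] by simp

lemma smult_closed': "x \<in> carrier X \<Longrightarrow> c \<odot> x \<in> carrier X"
  by (rule smult_closed) auto

lemma smult_smult: "x \<in> carrier X \<Longrightarrow> a \<odot> (b \<odot> x) = (a * b) \<odot> x"
  using smult_assoc1[of a b x] by simp

lemma smult_1: "x \<in> carrier X \<Longrightarrow> 1 \<odot> x = x"
  using smult_one by simp

lemma smult_add: "x \<in> carrier X \<Longrightarrow> y \<in> carrier X \<Longrightarrow> c \<odot> (x \<oplus> y) = c \<odot> x \<oplus> c \<odot> y"
  by (rule smult_r_distr) auto

lemma smult_diff: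
  "x \<in> carrier X \<Longrightarrow> y \<in> carrier X \<Longrightarrow> c \<odot> (x \<ominus> y) = c \<odot> x \<ominus> c \<odot> y"
  using smult_r_minus[of c y] by (simp add: a_minus_def smult_add)

lemma vnorm_zero [simp]: "\<parallel>\<zero>\<parallel> = 0"
  by (simp add: vnorm_eq_0_iff)

lemma vnorm_a_inv: "x \<in> carrier X \<Longrightarrow> \<parallel>\<ominus> x\<parallel> = \<parallel>x\<parallel>"
  by (simp add: a_inv_eq_smult vnorm_smult)

lemma vnorm_minus_commute:
  assumes "x \<in> carrier X" "y \<in> carrier X"
  shows "\<parallel>x \<ominus> y\<parallel> = \<parallel>y \<ominus> x\<parallel>"
proof -
  have "\<ominus> (x \<ominus> y) = y \<ominus> x"
    using assms by (simp add: a_minus_def M.minus_add M.a_comm)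
  then show ?thesis
    using vnorm_a_inv[of "x \<ominus> y"] assms by simp
qed

lemma vnorm_triangle_minus:
  "x \<in> carrier X \<Longrightarrow> y \<in> carrier X \<Longrightarrow> \<parallel>x \<ominus> y\<parallel> \<le> \<parallel>x\<parallel> + \<parallel>y\<parallel>"
  using vnorm_triangle[of x "\<ominus> y"] by (simp add: a_minus_def vnorm_a_inv)

lemma diff_add_diff:
  assumes "x \<in> carrier X" "y \<in> carrier X" "z \<in> carrier X"
  shows "(x \<ominus> y) \<oplus> (y \<ominus> z) = x \<ominus> z"
proof -
  have "(x \<ominus> y) \<oplus> (y \<ominus> z) = x \<oplus> ((\<ominus> y \<oplus> y) \<oplus> \<ominus> z)"
    using assms unfolding a_minus_def by (simp add: M.a_assoc del: M.l_neg)
  then show ?thesis using assms by (simp add: M.l_neg a_minus_def)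
qed

lemma vnorm_diff_triangle:
  "x \<in> carrier X \<Longrightarrow> y \<in> carrier X \<Longrightarrow> z \<in> carrier X \<Longrightarrow>
    \<parallel>x \<ominus> z\<parallel> \<le> \<parallel>x \<ominus> y\<parallel> + \<parallel>y \<ominus> z\<parallel>"
  using vnorm_triangle[of "x \<ominus> y" "y \<ominus> z"] diff_add_diff[of x y z] by simp

text \<open>The map \<open>y\<close> to \<open>x \<ominus> y\<close> is an isometry, so it preserves
  Cauchy sequences and limits. The completeness proof for the sum uses it both in the sum and in
  each summand.\<close>

lemma vnorm_diff_diff:
  assumes "x \<in> carrier X" "y \<in> carrier X" "z \<in> carrier X"
  shows "\<parallel>(x \<ominus> y) \<ominus> (x \<ominus> z)\<parallel> = \<parallel>y \<ominus> z\<parallel>"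
proof -
  have "\<ominus> (x \<ominus> z) = z \<ominus> x"
    using assms by (simp add: a_minus_def M.minus_add M.a_comm)
  then have "(x \<ominus> y) \<ominus> (x \<ominus> z) = (z \<ominus> x) \<oplus> (x \<ominus> y)"
    using assms by (simp add: a_minus_def[of _ "x \<ominus> y"] a_minus_def[of _ "x \<ominus> z"] M.a_comm)
  then show ?thesis
    using assms by (simp add: diff_add_diff vnorm_minus_commute[of z y])
qed

lemma vnorm_reverse_triangle:
  assumes "x \<in> carrier X" "y \<in> carrier X"
  shows "\<bar>\<parallel>x\<parallel> - \<parallel>y\<parallel>\<bar> \<le> \<parallel>x \<ominus> y\<parallel>"
proof -
  have "u \<ominus> \<zero> = u" if "u \<in> carrier X" for u
    using that by (simp add: a_minus_def a_inv_eq_smult)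
  then show ?thesis
    using vnorm_diff_triangle[of x y \<zero>] vnorm_diff_triangle[of y x \<zero>] assms
      vnorm_minus_commute[of x y] by simp
qed

lemma vnorm_diff_eq_0_iff:
  assumes "x \<in> carrier X" "y \<in> carrier X"
  shows "\<parallel>x \<ominus> y\<parallel> = 0 \<longleftrightarrow> x = y"
proof -
  have "x \<ominus> y = \<zero> \<longleftrightarrow> x = y"
    using assms M.minus_equality[of x "\<ominus> y"] M.r_neg[of y] by (auto simp: a_minus_def)
  then show ?thesis
    using assms by (simp add: vnorm_eq_0_iff)
qed

lemma Metric_space_norm_dist: "Metric_space (carrier X) (norm_dist X)"
  by unfold_locales
    (auto simp: norm_dist_def vnorm_nonneg vnorm_diff_eq_0_iff
      intro: vnorm_minus_commute vnorm_diff_triangle)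

text \<open>All points that occur lie in the carrier, so the default value 0 of
  \<open>norm_dist\<close> never intervenes. Completeness can from here on be handled with real
  sequences of norms alone.\<close>

lemma mcomplete_norm_dist_iff:
  "Metric_space.mcomplete (carrier X) (norm_dist X) \<longleftrightarrow>
    (\<forall>\<sigma>. range \<sigma> \<subseteq> carrier X \<longrightarrow> (\<forall>\<epsilon>>0. \<exists>M. \<forall>m\<ge>M. \<forall>n\<ge>M. \<parallel>\<sigma> m \<ominus> \<sigma> n\<parallel> < \<epsilon>) \<longrightarrow>
      (\<exists>l\<in>carrier X. (\<lambda>n. \<parallel>\<sigma> n \<ominus> l\<parallel>) \<longlonglongrightarrow> 0))"
proof -
  interpret Metric_space "carrier X" "norm_dist X" by (rule Metric_space_norm_dist)
  have cau: "MCauchy \<sigma> \<longleftrightarrow> (\<forall>\<epsilon>>0. \<exists>M. \<forall>m\<ge>M. \<forall>n\<ge>M. \<parallel>\<sigma> m \<ominus> \<sigma> n\<parallel> < \<epsilon>)"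
    if "range \<sigma> \<subseteq> carrier X" for \<sigma> :: "nat \<Rightarrow> 'a"
    using that by (auto simp: MCauchy_def norm_dist_def image_subset_iff)
  have lim: "limitin mtopology \<sigma> l sequentially \<longleftrightarrow> l \<in> carrier X \<and> (\<lambda>n. \<parallel>\<sigma> n \<ominus> l\<parallel>) \<longlonglongrightarrow> 0"
    if "range \<sigma> \<subseteq> carrier X" for \<sigma> l
  proof -
    have "\<sigma> n \<in> carrier X" for n using that by auto
    then show ?thesis by (auto simp: limitin_metric_dist_null norm_dist_def)
  qed
  have "(MCauchy \<sigma> \<longrightarrow> (\<exists>l. limitin mtopology \<sigma> l sequentially)) \<longleftrightarrow>
    (range \<sigma> \<subseteq> carrier X \<longrightarrow> (\<forall>\<epsilon>>0. \<exists>M. \<forall>m\<ge>M. \<forall>n\<ge>M. \<parallel>\<sigma> m \<ominus> \<sigma> n\<parallel> < \<epsilon>) \<longrightarrow>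
      (\<exists>l\<in>carrier X. (\<lambda>n. \<parallel>\<sigma> n \<ominus> l\<parallel>) \<longlonglongrightarrow> 0))" for \<sigma>
  proof (cases "range \<sigma> \<subseteq> carrier X")
    case True
    then show ?thesis by (simp add: cau lim Bex_def)
  qed (simp add: MCauchy_def)
  then show ?thesis unfolding mcomplete_def by simp
qed

end

lemma banach_spaceI:
  assumes "real_normed_space X"
    and "\<And>\<sigma>. (\<And>n. \<sigma> n \<in> carrier X) \<Longrightarrow>
      (\<And>\<epsilon>. \<epsilon> > 0 \<Longrightarrow> \<exists>M. \<forall>m\<ge>M. \<forall>n\<ge>M. \<parallel>\<sigma> m \<ominus>\<^bsub>X\<^esub> \<sigma> n\<parallel>\<^bsub>X\<^esub> < \<epsilon>) \<Longrightarrow>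
      \<exists>l\<in>carrier X. (\<lambda>n. \<parallel>\<sigma> n \<ominus>\<^bsub>X\<^esub> l\<parallel>\<^bsub>X\<^esub>) \<longlonglongrightarrow> 0"
  shows "banach_space X"
  using assms unfolding banach_space_def
  by (auto simp: real_normed_space.mcomplete_norm_dist_iff[OF assms(1)] image_subset_iff)

lemma banach_space_complete:
  assumes "banach_space X" and "\<And>n. \<sigma> n \<in> carrier X"
    and "\<And>\<epsilon>. \<epsilon> > 0 \<Longrightarrow> \<exists>M. \<forall>m\<ge>M. \<forall>n\<ge>M. \<parallel>\<sigma> m \<ominus>\<^bsub>X\<^esub> \<sigma> n\<parallel>\<^bsub>X\<^esub> < \<epsilon>"
  obtains l where "l \<in> carrier X" "(\<lambda>n. \<parallel>\<sigma> n \<ominus>\<^bsub>X\<^esub> l\<parallel>\<^bsub>X\<^esub>) \<longlonglongrightarrow> 0"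
proof -
  have "range \<sigma> \<subseteq> carrier X" using assms(2) by auto
  moreover have "real_normed_space X"
    using assms(1) by (simp add: banach_space_def)
  ultimately have "\<exists>l\<in>carrier X. (\<lambda>n. \<parallel>\<sigma> n \<ominus>\<^bsub>X\<^esub> l\<parallel>\<^bsub>X\<^esub>) \<longlonglongrightarrow> 0"
    using assms(1,3) by (simp add: banach_space_def real_normed_space.mcomplete_norm_dist_iff)
  with that show thesis by blast
qed

text \<open>Homogeneous form of the property: a coordinate of a unit vector of the sum may have any
  norm, including 0. For nonzero \<open>x\<close> the sequence at the normalised vector is
  multiplied by the norm of \<open>x\<close>, which commutes with all four limits. The bound by the
  norm of \<open>x\<close> is the inequality from which domination in the sum is later
  derived.\<close>

lemma WASQ_scaled:
  assumes "WASQ X" and x: "x \<in> carrier X"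
  shows "\<exists>y. (\<forall>n. y n \<in> carrier X \<and> \<parallel>y n\<parallel>\<^bsub>X\<^esub> \<le> \<parallel>x\<parallel>\<^bsub>X\<^esub>) \<and>
    (\<lambda>n. \<parallel>x \<oplus>\<^bsub>X\<^esub> y n\<parallel>\<^bsub>X\<^esub>) \<longlonglongrightarrow> \<parallel>x\<parallel>\<^bsub>X\<^esub> \<and> (\<lambda>n. \<parallel>x \<ominus>\<^bsub>X\<^esub> y n\<parallel>\<^bsub>X\<^esub>) \<longlonglongrightarrow> \<parallel>x\<parallel>\<^bsub>X\<^esub> \<and>
    (\<lambda>n. \<parallel>y n\<parallel>\<^bsub>X\<^esub>) \<longlonglongrightarrow> \<parallel>x\<parallel>\<^bsub>X\<^esub> \<and> weakly_convergent_to X y \<zero>\<^bsub>X\<^esub>"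
proof -
  have "banach_space X" using assms by (simp add: WASQ_def)
  then interpret real_normed_space X by (simp add: banach_space_def)
  show ?thesis
  proof (cases "x = \<zero>\<^bsub>X\<^esub>")
    case True
    \<comment> \<open>The zero vector cannot be normalised. The zero sequence serves instead, as all
      the prescribed limits are 0.\<close>
    then show ?thesis
      by (intro exI[of _ "\<lambda>n. \<zero>\<^bsub>X\<^esub>"]) (auto simp: a_minus_def vnorm_a_inv weakly_convergent_to_def)
  next
    case False
    define r where "r = \<parallel>x\<parallel>\<^bsub>X\<^esub>"
    define u where "u = inverse r \<odot>\<^bsub>X\<^esub> x"
    have r: "r > 0"
      using False x vnorm_nonneg[of x] vnorm_eq_0_iff[of x] by (simp add: r_def)
    have uX: "u \<in> carrier X"
      using x by (simp add: u_def smult_closed')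
    have x_eq: "x = r \<odot>\<^bsub>X\<^esub> u"
      using x r by (simp add: u_def smult_smult smult_1)
    have "\<parallel>u\<parallel>\<^bsub>X\<^esub> = \<bar>inverse r\<bar> * r"
      unfolding u_def by (simp only: vnorm_smult[OF x] r_def)
    then have u: "u \<in> unit_sphere X"
      using uX r by (simp add: unit_sphere_def)
    from \<open>WASQ X\<close> u obtain z where z: "\<And>n. z n \<in> unit_ball X"
      and lims: "(\<lambda>n. \<parallel>u \<oplus>\<^bsub>X\<^esub> z n\<parallel>\<^bsub>X\<^esub>) \<longlonglongrightarrow> 1" "(\<lambda>n. \<parallel>u \<ominus>\<^bsub>X\<^esub> z n\<parallel>\<^bsub>X\<^esub>) \<longlonglongrightarrow> 1" "(\<lambda>n. \<parallel>z n\<parallel>\<^bsub>X\<^esub>) \<longlonglongrightarrow> 1"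
      and wk: "weakly_convergent_to X z \<zero>\<^bsub>X\<^esub>"
      unfolding WASQ_def by blast
    have zX: "z n \<in> carrier X" "\<parallel>z n\<parallel>\<^bsub>X\<^esub> \<le> 1" for n
      using z by (auto simp: unit_ball_def)
    let ?y = "\<lambda>n. r \<odot>\<^bsub>X\<^esub> z n"
    have plus: "\<parallel>x \<oplus>\<^bsub>X\<^esub> ?y n\<parallel>\<^bsub>X\<^esub> = r * \<parallel>u \<oplus>\<^bsub>X\<^esub> z n\<parallel>\<^bsub>X\<^esub>" for n
    proof -
      have "x \<oplus>\<^bsub>X\<^esub> ?y n = r \<odot>\<^bsub>X\<^esub> (u \<oplus>\<^bsub>X\<^esub> z n)"
        using smult_add[of u "z n" r] uX zX by (simp add: x_eq)
      then show ?thesis using uX zX r by (simp add: vnorm_smult)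
    qed
    have minus: "\<parallel>x \<ominus>\<^bsub>X\<^esub> ?y n\<parallel>\<^bsub>X\<^esub> = r * \<parallel>u \<ominus>\<^bsub>X\<^esub> z n\<parallel>\<^bsub>X\<^esub>" for n
    proof -
      have "x \<ominus>\<^bsub>X\<^esub> ?y n = r \<odot>\<^bsub>X\<^esub> (u \<ominus>\<^bsub>X\<^esub> z n)"
        using smult_diff[of u "z n" r] uX zX by (simp add: x_eq)
      then show ?thesis using uX zX r by (simp add: vnorm_smult)
    qed
    have norm_y: "\<parallel>?y n\<parallel>\<^bsub>X\<^esub> = r * \<parallel>z n\<parallel>\<^bsub>X\<^esub>" for n
      using zX r by (simp add: vnorm_smult)
    have "weakly_convergent_to X ?y \<zero>\<^bsub>X\<^esub>"
      unfolding weakly_convergent_to_def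
    proof (intro conjI ballI)
      fix f assume f: "f \<in> dual X"
      then have f_smult: "f (c \<odot>\<^bsub>X\<^esub> v) = c * f v" if "v \<in> carrier X" for c v
        using that by (simp add: dual_def)
      have f0: "f \<zero>\<^bsub>X\<^esub> = 0" using f_smult[of "\<zero>\<^bsub>X\<^esub>" 0] by simp
      have "(\<lambda>n. f (z n)) \<longlonglongrightarrow> 0"
        using wk f f0 by (auto simp: weakly_convergent_to_def)
      then show "(\<lambda>n. f (?y n)) \<longlonglongrightarrow> f \<zero>\<^bsub>X\<^esub>"
        using tendsto_mult_right_zero[of "\<lambda>n. f (z n)" sequentially r] zX by (simp add: f0 f_smult)
    qed (auto simp: zX smult_closed')
    moreover have "?y n \<in> carrier X \<and> \<parallel>?y n\<parallel>\<^bsub>X\<^esub> \<le> r" for n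
      unfolding norm_y using zX r by (simp add: smult_closed' mult_left_le)
    moreover have "(\<lambda>n. \<parallel>x \<oplus>\<^bsub>X\<^esub> ?y n\<parallel>\<^bsub>X\<^esub>) \<longlonglongrightarrow> r" "(\<lambda>n. \<parallel>x \<ominus>\<^bsub>X\<^esub> ?y n\<parallel>\<^bsub>X\<^esub>) \<longlonglongrightarrow> r"
      "(\<lambda>n. \<parallel>?y n\<parallel>\<^bsub>X\<^esub>) \<longlonglongrightarrow> r"
      unfolding plus minus norm_y
      using tendsto_mult_left[OF lims(1), of r] tendsto_mult_left[OF lims(2), of r]
        tendsto_mult_left[OF lims(3), of r] by simp_all
    ultimately show ?thesis
      unfolding r_def[symmetric] by (intro exI[of _ ?y] conjI allI) simp_all
  qed
qed

section \<open>Absolute norms\<close>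

locale absolute_normed_space =
  fixes I :: "'i set" and E :: "('i \<Rightarrow> real) set" and N :: "('i \<Rightarrow> real) \<Rightarrow> real"
  assumes absolute_norm: "absolute_norm I E N"
begin

abbreviation "fs \<equiv> function_space I E N"

lemma fs_simps [simp]:
  "carrier fs = E" "\<zero>\<^bsub>fs\<^esub> = (\<lambda>i\<in>I. 0)" "a \<oplus>\<^bsub>fs\<^esub> b = (\<lambda>i\<in>I. a i + b i)"
  "c \<odot>\<^bsub>fs\<^esub> a = (\<lambda>i\<in>I. c * a i)" "\<parallel>a\<parallel>\<^bsub>fs\<^esub> = N a"
  by (simp_all add: function_space_def real_functions_def)

lemma banach_fs: "banach_space fs"
  using absolute_norm by (simp add: absolute_norm_def)

sublocale fs: real_normed_space fs
  using banach_fs by (simp add: banach_space_def)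

text \<open>Addition in \<open>function_space\<close> returns a restriction to \<open>I\<close>, and
  the identity 0 + a = a exhibits \<open>a\<close> as such a restriction.\<close>

lemma E_extensional: "a \<in> E \<Longrightarrow> a \<in> extensional I"
  using fs.M.l_zero[of a] restrict_extensional[of "\<lambda>i. (\<lambda>i\<in>I. 0) i + a i" I] by simp

lemma E_restrict: "a \<in> E \<Longrightarrow> (\<lambda>i\<in>I. a i) = a"
  by (rule extensional_restrict[OF E_extensional])

text \<open>Solidity in the form used throughout: \<open>b\<close> need not be extensional, so
  tails, differences and norm families can be inserted as plain lambda terms.\<close>

lemma ideal:
  assumes "a \<in> E" "\<And>i. i \<in> I \<Longrightarrow> \<bar>b i\<bar> \<le> \<bar>a i\<bar>"
  shows "(\<lambda>i\<in>I. b i) \<in> E" "N (\<lambda>i\<in>I. b i) \<le> N a"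
proof -
  have "a \<in> I \<rightarrow>\<^sub>E UNIV" "(\<lambda>i\<in>I. b i) \<in> I \<rightarrow>\<^sub>E UNIV"
    using E_extensional[OF assms(1)] by (auto simp: PiE_def)
  moreover have "\<forall>i\<in>I. \<bar>(\<lambda>i\<in>I. b i) i\<bar> \<le> \<bar>a i\<bar>"
    using assms(2) by simp
  ultimately have "(\<lambda>i\<in>I. b i) \<in> E \<and> N (\<lambda>i\<in>I. b i) \<le> N a"
    using absolute_norm assms(1) unfolding absolute_norm_def by blast
  then show "(\<lambda>i\<in>I. b i) \<in> E" "N (\<lambda>i\<in>I. b i) \<le> N a" by auto
qed

lemma E_add: "a \<in> E \<Longrightarrow> b \<in> E \<Longrightarrow> (\<lambda>i\<in>I. a i + b i) \<in> E"
  using fs.M.a_closed[of a b] by simp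

lemma N_add: "a \<in> E \<Longrightarrow> b \<in> E \<Longrightarrow> N (\<lambda>i\<in>I. a i + b i) \<le> N a + N b"
  using fs.vnorm_triangle[of a b] by simp

lemma E_scale: "a \<in> E \<Longrightarrow> (\<lambda>i\<in>I. c * a i) \<in> E"
  using fs.smult_closed'[of a c] by simp

lemma N_scale: "a \<in> E \<Longrightarrow> N (\<lambda>i\<in>I. c * a i) = \<bar>c\<bar> * N a"
  using fs.vnorm_smult[of a c] by simp

lemma N_nonneg: "a \<in> E \<Longrightarrow> 0 \<le> N a"
  using fs.vnorm_nonneg[of a] by simp

lemma fs_diff: "a \<in> E \<Longrightarrow> b \<in> E \<Longrightarrow> a \<ominus>\<^bsub>fs\<^esub> b = (\<lambda>i\<in>I. a i - b i)"
  by (auto simp: a_minus_def fs.a_inv_eq_smult)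

lemma E_diff: "a \<in> E \<Longrightarrow> b \<in> E \<Longrightarrow> (\<lambda>i\<in>I. a i - b i) \<in> E"
  using fs.M.minus_closed[of a b] by (simp add: fs_diff)

lemma N_reverse_triangle: "a \<in> E \<Longrightarrow> b \<in> E \<Longrightarrow> \<bar>N a - N b\<bar> \<le> N (\<lambda>i\<in>I. a i - b i)"
  using fs.vnorm_reverse_triangle[of a b] by (simp add: fs_diff)

lemma unit_vector_E: "i \<in> I \<Longrightarrow> unit_vector I i \<in> E"
  and N_unit_vector: "i \<in> I \<Longrightarrow> N (unit_vector I i) = 1"
  using absolute_norm by (auto simp: absolute_norm_def)

text \<open>The multiple \<open>a i\<close> of the \<open>i\<close>-th unit vector has norm
  \<open>\<bar>a i\<bar>\<close> and is dominated by \<open>a\<close>. Hence each coordinate is a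
  contraction, and norm limits determine coordinatewise limits.\<close>

lemma abs_coord_le:
  assumes "a \<in> E" "i \<in> I"
  shows "\<bar>a i\<bar> \<le> N a"
proof -
  have "\<bar>a i\<bar> = N (\<lambda>j\<in>I. a i * unit_vector I i j)"
    using assms by (simp add: N_scale unit_vector_E N_unit_vector)
  also have "\<dots> \<le> N a"
    using assms(2) by (intro ideal(2)[OF assms(1)]) (auto simp: unit_vector_def)
  finally show ?thesis .
qed

text \<open>By completeness the sequence has a norm limit, and norm limits are coordinatewise.\<close>

lemma Cauchy_coordinatewise_limit:
  assumes aE: "\<And>n. a n \<in> E"
    and Cauchy: "\<And>\<epsilon>. \<epsilon> > 0 \<Longrightarrow> \<exists>M. \<forall>m\<ge>M. \<forall>n\<ge>M. N (\<lambda>i\<in>I. a m i - a n i) < \<epsilon>"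
    and lim: "\<And>i. i \<in> I \<Longrightarrow> (\<lambda>n. a n i) \<longlonglongrightarrow> b i"
  shows "(\<lambda>i\<in>I. b i) \<in> E" "(\<lambda>n. N (a n)) \<longlonglongrightarrow> N (\<lambda>i\<in>I. b i)"
proof -
  obtain l where lE: "l \<in> E" and "(\<lambda>n. \<parallel>a n \<ominus>\<^bsub>fs\<^esub> l\<parallel>\<^bsub>fs\<^esub>) \<longlonglongrightarrow> 0"
    using banach_space_complete[OF banach_fs, of a] aE Cauchy by (auto simp: fs_diff)
  then have l: "(\<lambda>n. N (\<lambda>i\<in>I. a n i - l i)) \<longlonglongrightarrow> 0"
    using aE by (simp add: fs_diff)
  have "l i = b i" if i: "i \<in> I" for i
  proof -
    have "\<bar>a n i - l i\<bar> \<le> N (\<lambda>i\<in>I. a n i - l i)" for n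
      using abs_coord_le[OF E_diff[OF aE lE] i] i by simp
    then have "(\<lambda>n. a n i - l i) \<longlonglongrightarrow> 0"
      by (intro Lim_null_comparison[OF _ l]) simp
    then have "(\<lambda>n. a n i) \<longlonglongrightarrow> l i"
      by (rule LIM_zero_cancel)
    with lim[OF i] show ?thesis by (simp add: LIMSEQ_unique)
  qed
  then have b: "(\<lambda>i\<in>I. b i) = l"
    using E_extensional[OF lE] by (auto simp: extensional_def fun_eq_iff)
  then show "(\<lambda>i\<in>I. b i) \<in> E" using lE by simp
  have "(\<lambda>n. N (a n) - N l) \<longlonglongrightarrow> 0"
    using N_reverse_triangle[OF aE lE] by (intro Lim_null_comparison[OF _ l]) simp
  then show "(\<lambda>n. N (a n)) \<longlonglongrightarrow> N (\<lambda>i\<in>I. b i)"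
    unfolding b by (rule LIM_zero_cancel)
qed

section \<open>Finite truncations and dominated convergence in \<open>E\<close>\<close>

lemma N_le_sum_plus_tail:
  assumes "a \<in> E" and "finite F" "F \<subseteq> I"
  shows "N a \<le> (\<Sum>i\<in>F. \<bar>a i\<bar>) + N (\<lambda>i\<in>I. if i \<in> F then 0 else a i)"
  using assms(2,3)
proof (induction F)
  case empty
  then show ?case using E_restrict[OF assms(1)] by simp
next
  case (insert j F)
  let ?t = "\<lambda>G. \<lambda>i\<in>I. if i \<in> G then 0 else a i" and ?s = "\<lambda>i\<in>I. a j * unit_vector I j i"
  have tE: "?t G \<in> E" for G
    by (rule ideal[OF assms(1)]) auto
  have j: "j \<in> I" using insert.prems by simp
  then have sE: "?s \<in> E" "N ?s = \<bar>a j\<bar>"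
    by (simp_all add: E_scale N_scale unit_vector_E N_unit_vector)
  \<comment> \<open>The two tails differ by \<open>a j\<close> times the \<open>j\<close>-th unit
    vector, so moving \<open>j\<close> into the finite set costs exactly the new summand
    \<open>\<bar>a j\<bar>\<close>.\<close>
  have "?t F = (\<lambda>i\<in>I. ?s i + ?t (insert j F) i)"
    using insert.hyps by (auto simp: unit_vector_def)
  then have "N (?t F) \<le> \<bar>a j\<bar> + N (?t (insert j F))"
    using N_add[OF sE(1) tE[of "insert j F"]] sE(2) by simp
  then show ?case using insert by (simp add: restrict_def)
qed

end

text \<open>This is the form in which density of the span enters: stated through truncations, it can
  be passed from a dominating element to everything below it by solidity.\<close>

locale order_continuous_absolute_normed_space = absolute_normed_space +
  assumes small_tail: "a \<in> E \<Longrightarrow> \<epsilon> > 0 \<Longrightarrow>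
    \<exists>F. finite F \<and> F \<subseteq> I \<and> N (\<lambda>i\<in>I. if i \<in> F then 0 else a i) < \<epsilon>"
begin

text \<open>The finite set \<open>F\<close> is chosen from \<open>a\<close> alone. By solidity it
  bounds the tails of all \<open>c n\<close> simultaneously, and over \<open>F\<close> there remains
  a finite sum of null sequences.\<close>

lemma dominated_null:
  assumes a: "a \<in> E"
    and bound: "\<And>n i. i \<in> I \<Longrightarrow> \<bar>c n i\<bar> \<le> \<bar>a i\<bar>"
    and lim: "\<And>i. i \<in> I \<Longrightarrow> (\<lambda>n. c n i) \<longlonglongrightarrow> 0"
  shows "(\<lambda>n. N (\<lambda>i\<in>I. c n i)) \<longlonglongrightarrow> 0"
proof (rule tendstoI)
  fix \<epsilon> :: real assume "\<epsilon> > 0"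
  then obtain F where F: "finite F" "F \<subseteq> I"
    and tail: "N (\<lambda>i\<in>I. if i \<in> F then 0 else a i) < \<epsilon> / 2"
    using small_tail[OF a, of "\<epsilon> / 2"] by auto
  have tE: "(\<lambda>i\<in>I. if i \<in> F then 0 else a i) \<in> E"
    by (rule ideal[OF a]) auto
  have cE: "(\<lambda>i\<in>I. c n i) \<in> E" for n
    by (rule ideal[OF a bound])
  have "(\<lambda>n. \<Sum>i\<in>F. \<bar>c n i\<bar>) \<longlonglongrightarrow> (\<Sum>i\<in>F. \<bar>0\<bar>)"
    using F lim by (intro tendsto_sum tendsto_rabs) auto
  then have "\<forall>\<^sub>F n in sequentially. (\<Sum>i\<in>F. \<bar>c n i\<bar>) < \<epsilon> / 2"
    using \<open>\<epsilon> > 0\<close> by (intro order_tendstoD(2)[of _ 0]) auto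
  then show "\<forall>\<^sub>F n in sequentially. dist (N (\<lambda>i\<in>I. c n i)) 0 < \<epsilon>"
  proof eventually_elim
    case (elim n)
    have "N (\<lambda>i\<in>I. if i \<in> F then 0 else (\<lambda>i\<in>I. c n i) i) \<le> N (\<lambda>i\<in>I. if i \<in> F then 0 else a i)"
      using bound by (intro ideal(2)[OF tE]) auto
    moreover have "(\<Sum>i\<in>F. \<bar>(\<lambda>i\<in>I. c n i) i\<bar>) = (\<Sum>i\<in>F. \<bar>c n i\<bar>)"
      using F by (intro sum.cong) auto
    ultimately have "N (\<lambda>i\<in>I. c n i) < \<epsilon>"
      using N_le_sum_plus_tail[OF cE[of n] F] tail elim by linarith
    then show ?case using N_nonneg[OF cE[of n]] by simp
  qed
qed

text \<open>The limit inherits the bound, so the differences are dominated by \<open>2 * a\<close>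
  and form a null sequence in norm. The reverse triangle inequality for \<open>N\<close> does the
  rest.\<close>

lemma dominated_convergence:
  assumes a: "a \<in> E"
    and bound: "\<And>n i. i \<in> I \<Longrightarrow> \<bar>b n i\<bar> \<le> a i"
    and lim: "\<And>i. i \<in> I \<Longrightarrow> (\<lambda>n. b n i) \<longlonglongrightarrow> l i"
  shows "(\<lambda>n. N (\<lambda>i\<in>I. b n i)) \<longlonglongrightarrow> N (\<lambda>i\<in>I. l i)"
proof -
  \<comment> \<open>The dominating function appears without absolute value in \<open>bound\<close>,
    which already forces it to be nonnegative on \<open>I\<close>. This is what makes
    \<open>ideal\<close> applicable.\<close>
  have a0: "0 \<le> a i" if "i \<in> I" for i
    using bound[OF that, of 0] by linarith
  have l: "\<bar>l i\<bar> \<le> a i" if "i \<in> I" for i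
    using tendsto_rabs[OF lim[OF that]] bound[OF that] by (intro LIMSEQ_le_const2) auto
  have E: "(\<lambda>i\<in>I. b n i) \<in> E" "(\<lambda>i\<in>I. l i) \<in> E" for n
    using bound[of _ n] l a0 by (intro ideal(1)[OF a]; simp)+
  have "\<bar>b n i - l i\<bar> \<le> \<bar>(\<lambda>i\<in>I. 2 * a i) i\<bar>" if "i \<in> I" for n i
    using bound[OF that, of n] l[OF that] that by auto
  moreover have "(\<lambda>n. b n i - l i) \<longlonglongrightarrow> 0" if "i \<in> I" for i
    using lim[OF that] by (rule LIM_zero)
  ultimately have lim0: "(\<lambda>n. N (\<lambda>i\<in>I. b n i - l i)) \<longlonglongrightarrow> 0"
    by (rule dominated_null[OF E_scale[OF a, of 2]])
  have "\<bar>N (\<lambda>i\<in>I. b n i) - N (\<lambda>i\<in>I. l i)\<bar> \<le> N (\<lambda>i\<in>I. b n i - l i)" for n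
    using N_reverse_triangle[OF E(1)[of n] E(2)] by (simp cong: restrict_cong)
  then have "(\<lambda>n. N (\<lambda>i\<in>I. b n i) - N (\<lambda>i\<in>I. l i)) \<longlonglongrightarrow> 0"
    by (intro Lim_null_comparison[OF _ lim0]) simp
  then show ?thesis by (rule LIM_zero_cancel)
qed

end

text \<open>Elements of the span of the unit vectors have finite support, and cutting off the coordinates
  in the support of an approximant of \<open>a\<close> leaves something dominated by the error.\<close>

lemma (in absolute_normed_space) dense_span_imp_order_continuous:
  assumes dense: "norm_topology fs closure_of linear_span fs (unit_vector I ` I) = E"
  shows "order_continuous_absolute_normed_space I E N"
proof unfold_locales
  fix a and \<epsilon> :: real assume a: "a \<in> E" and "\<epsilon> > 0"
  interpret metric: Metric_space E "norm_dist fs"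
    using fs.Metric_space_norm_dist by simp
  \<comment> \<open>The span is a hull, so linear combinations need not be described: it suffices to
    exhibit one submodule of finitely supported elements that contains the unit vectors.\<close>
  let ?H = "{b \<in> E. finite {i \<in> I. b i \<noteq> 0}}"
  have "submodule ?H real_ring fs"
  proof (rule fs.submoduleI)
    show smult: "c \<odot>\<^bsub>fs\<^esub> b \<in> ?H" if "b \<in> ?H" for c b
    proof -
      have "{i \<in> I. (\<lambda>i\<in>I. c * b i) i \<noteq> 0} \<subseteq> {i \<in> I. b i \<noteq> 0}" by auto
      then have "finite {i \<in> I. (\<lambda>i\<in>I. c * b i) i \<noteq> 0}"
        by (rule finite_subset) (use that in simp)
      then show ?thesis using that E_scale[of b c] by simp
    qed
    show "\<ominus>\<^bsub>fs\<^esub> b \<in> ?H" if "b \<in> ?H" for b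
    proof -
      have "\<ominus>\<^bsub>fs\<^esub> b = (- 1) \<odot>\<^bsub>fs\<^esub> b" using that by (intro fs.a_inv_eq_smult) simp
      then show ?thesis using smult[OF that, of "- 1"] by (simp only:)
    qed
    show "b \<oplus>\<^bsub>fs\<^esub> c \<in> ?H" if "b \<in> ?H" "c \<in> ?H" for b c
    proof -
      have "{i \<in> I. (\<lambda>i\<in>I. b i + c i) i \<noteq> 0} \<subseteq> {i \<in> I. b i \<noteq> 0} \<union> {i \<in> I. c i \<noteq> 0}" by auto
      then have "finite {i \<in> I. (\<lambda>i\<in>I. b i + c i) i \<noteq> 0}"
        by (rule finite_subset) (use that in simp)
      then show ?thesis using that E_add[of b c] by simp
    qed
    show "\<zero>\<^bsub>fs\<^esub> \<in> ?H" using fs.M.zero_closed by simp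
  qed auto
  moreover have "unit_vector I ` I \<subseteq> ?H"
    by (auto simp: unit_vector_E) (simp add: unit_vector_def)
  ultimately have span: "linear_span fs (unit_vector I ` I) \<subseteq> ?H"
    unfolding linear_span_def by (rule hull_minimal[rotated])
  have "a \<in> metric.mtopology closure_of linear_span fs (unit_vector I ` I)"
    using dense a by (simp add: norm_topology_def)
  then obtain s where "s \<in> linear_span fs (unit_vector I ` I)" "norm_dist fs a s < \<epsilon>"
    using \<open>\<epsilon> > 0\<close> by (auto simp: metric.metric_closure_of)
  then have s: "s \<in> E" "finite {i \<in> I. s i \<noteq> 0}" "N (\<lambda>i\<in>I. a i - s i) < \<epsilon>"
    using span a by (auto simp: norm_dist_def fs_diff)
  have "N (\<lambda>i\<in>I. if i \<in> {i \<in> I. s i \<noteq> 0} then 0 else a i) \<le> N (\<lambda>i\<in>I. a i - s i)"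
    by (rule ideal(2)[OF E_diff[OF a s(1)]]) auto
  then show "\<exists>F. finite F \<and> F \<subseteq> I \<and> N (\<lambda>i\<in>I. if i \<in> F then 0 else a i) < \<epsilon>"
    using s by (intro exI[of _ "{i \<in> I. s i \<noteq> 0}"]) auto
qed

section \<open>Absolute sums\<close>

locale banach_family = absolute_normed_space I E N
  for I :: "'i set" and E :: "('i \<Rightarrow> real) set" and N :: "('i \<Rightarrow> real) \<Rightarrow> real" +
  fixes X :: "'i \<Rightarrow> 'a normed_module"
  assumes banach: "i \<in> I \<Longrightarrow> banach_space (X i)"
begin

abbreviation "S \<equiv> absolute_sum I E N X"

lemma normed: "i \<in> I \<Longrightarrow> real_normed_space (X i)"
  using banach by (simp add: banach_space_def)

lemma module_X: "i \<in> I \<Longrightarrow> Module.module real_ring (X i)"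
  using normed by (rule real_normed_space.axioms)

lemma abelian_group_X: "i \<in> I \<Longrightarrow> abelian_group (X i)"
  using module_X by (rule Module.module.axioms)

lemma zero_closed_X: "i \<in> I \<Longrightarrow> \<zero>\<^bsub>X i\<^esub> \<in> carrier (X i)"
  using abelian_group_X by (blast intro: abelian_monoid.zero_closed abelian_group.axioms(1))

lemma sum_simps [simp]:
  "\<zero>\<^bsub>S\<^esub> = (\<lambda>i\<in>I. \<zero>\<^bsub>X i\<^esub>)" "x \<oplus>\<^bsub>S\<^esub> y = (\<lambda>i\<in>I. x i \<oplus>\<^bsub>X i\<^esub> y i)"
  "c \<odot>\<^bsub>S\<^esub> x = (\<lambda>i\<in>I. c \<odot>\<^bsub>X i\<^esub> x i)" "\<parallel>x\<parallel>\<^bsub>S\<^esub> = N (\<lambda>i\<in>I. \<parallel>x i\<parallel>\<^bsub>X i\<^esub>)"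
  by (simp_all add: absolute_sum_def norm_family_def)

lemma carrier_sum_iff:
  "x \<in> carrier S \<longleftrightarrow>
    x \<in> extensional I \<and> (\<forall>i\<in>I. x i \<in> carrier (X i)) \<and> (\<lambda>i\<in>I. \<parallel>x i\<parallel>\<^bsub>X i\<^esub>) \<in> E"
  by (auto simp: absolute_sum_def norm_family_def PiE_def Pi_def)

lemma coord_closed: "x \<in> carrier S \<Longrightarrow> i \<in> I \<Longrightarrow> x i \<in> carrier (X i)"
  and norms_E: "x \<in> carrier S \<Longrightarrow> (\<lambda>i\<in>I. \<parallel>x i\<parallel>\<^bsub>X i\<^esub>) \<in> E"
  and sum_restrict: "x \<in> carrier S \<Longrightarrow> (\<lambda>i\<in>I. x i) = x"
  by (auto simp: carrier_sum_iff extensional_restrict)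

lemma sum_eqI:
  assumes "x \<in> carrier S" "y \<in> carrier S" "\<And>i. i \<in> I \<Longrightarrow> x i = y i"
  shows "x = y"
  using assms by (auto simp: carrier_sum_iff intro: extensionalityI)

text \<open>Solidity lifted from \<open>E\<close> to the sum. A family built coordinate by
  coordinate is shown to lie in the carrier by bounding its norms by an element of
  \<open>E\<close>.\<close>

lemma dominated_in_sum:
  assumes "a \<in> E"
    and "\<And>i. i \<in> I \<Longrightarrow> y i \<in> carrier (X i)" "\<And>i. i \<in> I \<Longrightarrow> \<parallel>y i\<parallel>\<^bsub>X i\<^esub> \<le> a i"
  shows "(\<lambda>i\<in>I. y i) \<in> carrier S" "N (\<lambda>i\<in>I. \<parallel>y i\<parallel>\<^bsub>X i\<^esub>) \<le> N a"
proof -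
  have "\<bar>\<parallel>y i\<parallel>\<^bsub>X i\<^esub>\<bar> \<le> \<bar>a i\<bar>" if "i \<in> I" for i
    using real_normed_space.vnorm_nonneg[OF normed[OF that] assms(2)[OF that]] assms(3)[OF that]
    by simp
  note * = ideal[OF assms(1) this]
  then show "(\<lambda>i\<in>I. y i) \<in> carrier S" "N (\<lambda>i\<in>I. \<parallel>y i\<parallel>\<^bsub>X i\<^esub>) \<le> N a"
    using assms(2) by (auto simp: carrier_sum_iff cong: restrict_cong)
qed

section \<open>The absolute sum as a normed space\<close>

lemma zero_in_sum: "(\<lambda>i\<in>I. \<zero>\<^bsub>X i\<^esub>) \<in> carrier S"
  using fs.M.zero_closed
  by (intro dominated_in_sum(1)[of "\<lambda>i\<in>I. 0"])
    (simp_all add: real_normed_space.vnorm_zero[OF normed] zero_closed_X)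

text \<open>Two triangle inequalities are composed: those of the summands bound the norm family of
  the sum by a sum of norm families, and monotonicity of \<open>N\<close> allows its own triangle
  inequality to follow.\<close>

lemma add_in_sum:
  assumes "x \<in> carrier S" "y \<in> carrier S"
  shows "(\<lambda>i\<in>I. x i \<oplus>\<^bsub>X i\<^esub> y i) \<in> carrier S"
    and "\<parallel>x \<oplus>\<^bsub>S\<^esub> y\<parallel>\<^bsub>S\<^esub> \<le> \<parallel>x\<parallel>\<^bsub>S\<^esub> + \<parallel>y\<parallel>\<^bsub>S\<^esub>"
proof -
  let ?n = "\<lambda>x. \<lambda>i\<in>I. \<parallel>x i\<parallel>\<^bsub>X i\<^esub>"
  have "x i \<oplus>\<^bsub>X i\<^esub> y i \<in> carrier (X i)" "\<parallel>x i \<oplus>\<^bsub>X i\<^esub> y i\<parallel>\<^bsub>X i\<^esub> \<le> (\<lambda>i\<in>I. ?n x i + ?n y i) i"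
    if i: "i \<in> I" for i
  proof -
    interpret real_normed_space "X i" by (rule normed[OF i])
    show "x i \<oplus>\<^bsub>X i\<^esub> y i \<in> carrier (X i)" "\<parallel>x i \<oplus>\<^bsub>X i\<^esub> y i\<parallel>\<^bsub>X i\<^esub> \<le> (\<lambda>i\<in>I. ?n x i + ?n y i) i"
      using assms[THEN coord_closed, OF i] i by (simp_all add: vnorm_triangle)
  qed
  note * = dominated_in_sum[OF E_add[OF assms[THEN norms_E]] this]
  show "(\<lambda>i\<in>I. x i \<oplus>\<^bsub>X i\<^esub> y i) \<in> carrier S" by (rule *(1))
  show "\<parallel>x \<oplus>\<^bsub>S\<^esub> y\<parallel>\<^bsub>S\<^esub> \<le> \<parallel>x\<parallel>\<^bsub>S\<^esub> + \<parallel>y\<parallel>\<^bsub>S\<^esub>"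
    using order_trans[OF *(2) N_add[OF assms[THEN norms_E]]] by (simp cong: restrict_cong)
qed

lemma smult_in_sum:
  assumes "x \<in> carrier S"
  shows "(\<lambda>i\<in>I. c \<odot>\<^bsub>X i\<^esub> x i) \<in> carrier S" and "\<parallel>c \<odot>\<^bsub>S\<^esub> x\<parallel>\<^bsub>S\<^esub> = \<bar>c\<bar> * \<parallel>x\<parallel>\<^bsub>S\<^esub>"
proof -
  have eq: "(\<lambda>i\<in>I. \<parallel>c \<odot>\<^bsub>X i\<^esub> x i\<parallel>\<^bsub>X i\<^esub>) = (\<lambda>i\<in>I. \<bar>c\<bar> * (\<lambda>i\<in>I. \<parallel>x i\<parallel>\<^bsub>X i\<^esub>) i)"
    using assms by (auto simp: real_normed_space.vnorm_smult[OF normed] coord_closed)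
  then show "(\<lambda>i\<in>I. c \<odot>\<^bsub>X i\<^esub> x i) \<in> carrier S"
    using E_scale[OF norms_E[OF assms], of "\<bar>c\<bar>"] coord_closed[OF assms]
    by (simp add: carrier_sum_iff real_normed_space.smult_closed'[OF normed] cong: restrict_cong)
  show "\<parallel>c \<odot>\<^bsub>S\<^esub> x\<parallel>\<^bsub>S\<^esub> = \<bar>c\<bar> * \<parallel>x\<parallel>\<^bsub>S\<^esub>"
    using eq N_scale[OF norms_E[OF assms], of "\<bar>c\<bar>"] by (simp cong: restrict_cong)
qed

lemma abelian_group_sum: "abelian_group S"
proof (rule abelian_groupI)
  show "x \<oplus>\<^bsub>S\<^esub> y \<in> carrier S" if "x \<in> carrier S" "y \<in> carrier S" for x y
    using add_in_sum(1)[OF that] by simp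
  show "\<zero>\<^bsub>S\<^esub> \<in> carrier S" using zero_in_sum by simp
  show "x \<oplus>\<^bsub>S\<^esub> y \<oplus>\<^bsub>S\<^esub> z = x \<oplus>\<^bsub>S\<^esub> (y \<oplus>\<^bsub>S\<^esub> z)"
    if "x \<in> carrier S" "y \<in> carrier S" "z \<in> carrier S" for x y z
    using that coord_closed
    by (auto simp: abelian_monoid.a_assoc[OF abelian_group.axioms(1)[OF abelian_group_X]])
  show "x \<oplus>\<^bsub>S\<^esub> y = y \<oplus>\<^bsub>S\<^esub> x" if "x \<in> carrier S" "y \<in> carrier S" for x y
    using that coord_closed
    by (auto simp: abelian_monoid.a_comm[OF abelian_group.axioms(1)[OF abelian_group_X]])
  show "\<zero>\<^bsub>S\<^esub> \<oplus>\<^bsub>S\<^esub> x = x" if "x \<in> carrier S" for x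
  proof -
    have "(\<lambda>i\<in>I. \<zero>\<^bsub>X i\<^esub> \<oplus>\<^bsub>X i\<^esub> x i) = (\<lambda>i\<in>I. x i)"
      using that coord_closed
      by (auto simp: abelian_monoid.l_zero[OF abelian_group.axioms(1)[OF abelian_group_X]])
    then show ?thesis using sum_restrict[OF that] by (simp cong: restrict_cong)
  qed
  show "\<exists>y\<in>carrier S. y \<oplus>\<^bsub>S\<^esub> x = \<zero>\<^bsub>S\<^esub>" if "x \<in> carrier S" for x
  proof
    \<comment> \<open>The inverse is supplied as a scaling by -1, whose membership in the carrier is
      already known.\<close>
    show "(\<lambda>i\<in>I. (- 1) \<odot>\<^bsub>X i\<^esub> x i) \<in> carrier S" by (rule smult_in_sum(1)[OF that])
    have "((- 1) \<odot>\<^bsub>X i\<^esub> x i) \<oplus>\<^bsub>X i\<^esub> x i = \<zero>\<^bsub>X i\<^esub>" if i: "i \<in> I" for i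
    proof -
      interpret real_normed_space "X i" by (rule normed[OF i])
      show ?thesis
        using a_inv_eq_smult[of "x i"] M.l_neg[of "x i"] coord_closed[OF \<open>x \<in> carrier S\<close> i] by simp
    qed
    then show "(\<lambda>i\<in>I. (- 1) \<odot>\<^bsub>X i\<^esub> x i) \<oplus>\<^bsub>S\<^esub> x = \<zero>\<^bsub>S\<^esub>" by auto
  qed
qed

lemma real_normed_space_sum: "real_normed_space S"
proof (intro real_normed_space.intro real_normed_space_axioms.intro moduleI)
  show "cring real_ring" by (rule cring_real_ring)
  show "abelian_group S" by (rule abelian_group_sum)
  fix x assume x: "x \<in> carrier S"
  note xi = coord_closed[OF x]
  show "c \<odot>\<^bsub>S\<^esub> x \<in> carrier S" for c using smult_in_sum(1)[OF x] by simp
  show "\<parallel>c \<odot>\<^bsub>S\<^esub> x\<parallel>\<^bsub>S\<^esub> = \<bar>c\<bar> * \<parallel>x\<parallel>\<^bsub>S\<^esub>" for c by (rule smult_in_sum(2)[OF x])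
  show "(c \<oplus>\<^bsub>real_ring\<^esub> d) \<odot>\<^bsub>S\<^esub> x = c \<odot>\<^bsub>S\<^esub> x \<oplus>\<^bsub>S\<^esub> d \<odot>\<^bsub>S\<^esub> x" for c d
  proof -
    have "(c + d) \<odot>\<^bsub>X i\<^esub> x i = c \<odot>\<^bsub>X i\<^esub> x i \<oplus>\<^bsub>X i\<^esub> d \<odot>\<^bsub>X i\<^esub> x i" if "i \<in> I" for i
      using Module.module.smult_l_distr[OF module_X[OF that], of c d "x i"] xi[OF that] by simp
    then show ?thesis by auto
  qed
  show "(c \<otimes>\<^bsub>real_ring\<^esub> d) \<odot>\<^bsub>S\<^esub> x = c \<odot>\<^bsub>S\<^esub> (d \<odot>\<^bsub>S\<^esub> x)" for c d
    using xi by (auto simp: real_normed_space.smult_smult[OF normed])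
  show "\<one>\<^bsub>real_ring\<^esub> \<odot>\<^bsub>S\<^esub> x = x"
  proof -
    have "(\<lambda>i\<in>I. 1 \<odot>\<^bsub>X i\<^esub> x i) = (\<lambda>i\<in>I. x i)"
      using xi by (auto simp: real_normed_space.smult_1[OF normed])
    then show ?thesis using sum_restrict[OF x] by simp
  qed
  show "0 \<le> \<parallel>x\<parallel>\<^bsub>S\<^esub>" using N_nonneg[OF norms_E[OF x]] by simp
  show "\<parallel>x\<parallel>\<^bsub>S\<^esub> = 0 \<longleftrightarrow> x = \<zero>\<^bsub>S\<^esub>"
  proof -
    have "\<parallel>x\<parallel>\<^bsub>S\<^esub> = 0 \<longleftrightarrow> (\<lambda>i\<in>I. \<parallel>x i\<parallel>\<^bsub>X i\<^esub>) = (\<lambda>i\<in>I. 0)"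
      using fs.vnorm_eq_0_iff[of "\<lambda>i\<in>I. \<parallel>x i\<parallel>\<^bsub>X i\<^esub>"] norms_E[OF x] by simp
    also have "\<dots> \<longleftrightarrow> (\<forall>i\<in>I. \<parallel>x i\<parallel>\<^bsub>X i\<^esub> = 0)"
      by (auto simp: fun_eq_iff)
    also have "\<dots> \<longleftrightarrow> (\<forall>i\<in>I. x i = \<zero>\<^bsub>X i\<^esub>)"
      using xi by (simp add: real_normed_space.vnorm_eq_0_iff[OF normed])
    also have "\<dots> \<longleftrightarrow> x = (\<lambda>i\<in>I. \<zero>\<^bsub>X i\<^esub>)"
      using sum_eqI[OF x zero_in_sum] by auto
    finally show ?thesis by simp
  qed
  fix y assume y: "y \<in> carrier S"
  show "c \<odot>\<^bsub>S\<^esub> (x \<oplus>\<^bsub>S\<^esub> y) = c \<odot>\<^bsub>S\<^esub> x \<oplus>\<^bsub>S\<^esub> c \<odot>\<^bsub>S\<^esub> y" for c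
    using xi coord_closed[OF y] by (auto simp: real_normed_space.smult_add[OF normed])
  show "\<parallel>x \<oplus>\<^bsub>S\<^esub> y\<parallel>\<^bsub>S\<^esub> \<le> \<parallel>x\<parallel>\<^bsub>S\<^esub> + \<parallel>y\<parallel>\<^bsub>S\<^esub>" by (rule add_in_sum(2)[OF x y])
qed

sublocale sum_space: real_normed_space S
  by (rule real_normed_space_sum)

lemma sum_diff:
  assumes "x \<in> carrier S" "y \<in> carrier S"
  shows "x \<ominus>\<^bsub>S\<^esub> y = (\<lambda>i\<in>I. x i \<ominus>\<^bsub>X i\<^esub> y i)"
  using assms coord_closed
  by (auto simp: a_minus_def sum_space.a_inv_eq_smult real_normed_space.a_inv_eq_smult[OF normed])

section \<open>Completeness of the absolute sum\<close>

lemma coord_norm_le: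
  assumes "x \<in> carrier S" "i \<in> I"
  shows "\<parallel>x i\<parallel>\<^bsub>X i\<^esub> \<le> \<parallel>x\<parallel>\<^bsub>S\<^esub>"
  using abs_coord_le[OF norms_E[OF assms(1)] assms(2)] assms(2) by simp

text \<open>By the reverse triangle inequality in each summand and solidity, the norm families form
  a Cauchy sequence in \<open>E\<close>, and coordinatewise they tend to the norm family of
  \<open>z\<close>. The conclusion concerns norms only; that \<open>x n\<close> tends to
  \<open>z\<close> is not yet asserted.\<close>

lemma Cauchy_coordinatewise_limit_sum:
  assumes x: "\<And>n. x n \<in> carrier S"
    and Cauchy: "\<And>\<epsilon>. \<epsilon> > 0 \<Longrightarrow> \<exists>M. \<forall>m\<ge>M. \<forall>n\<ge>M. \<parallel>x m \<ominus>\<^bsub>S\<^esub> x n\<parallel>\<^bsub>S\<^esub> < \<epsilon>"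
    and z: "\<And>i. i \<in> I \<Longrightarrow> z i \<in> carrier (X i)"
    and lim: "\<And>i. i \<in> I \<Longrightarrow> (\<lambda>n. \<parallel>x n i \<ominus>\<^bsub>X i\<^esub> z i\<parallel>\<^bsub>X i\<^esub>) \<longlonglongrightarrow> 0"
  shows "(\<lambda>i\<in>I. z i) \<in> carrier S" "(\<lambda>n. \<parallel>x n\<parallel>\<^bsub>S\<^esub>) \<longlonglongrightarrow> \<parallel>\<lambda>i\<in>I. z i\<parallel>\<^bsub>S\<^esub>"
proof -
  define a where "a n = (\<lambda>i\<in>I. \<parallel>x n i\<parallel>\<^bsub>X i\<^esub>)" for n
  have a_diff: "N (\<lambda>i\<in>I. a m i - a n i) \<le> \<parallel>x m \<ominus>\<^bsub>S\<^esub> x n\<parallel>\<^bsub>S\<^esub>" for m n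
  proof -
    have "x m \<ominus>\<^bsub>S\<^esub> x n \<in> carrier S" using x by simp
    then have "N (\<lambda>i\<in>I. a m i - a n i) \<le> N (\<lambda>i\<in>I. \<parallel>(x m \<ominus>\<^bsub>S\<^esub> x n) i\<parallel>\<^bsub>X i\<^esub>)"
    proof (intro ideal(2)[OF norms_E])
      fix i assume i: "i \<in> I"
      interpret real_normed_space "X i" by (rule normed[OF i])
      have "\<bar>\<parallel>x m i\<parallel>\<^bsub>X i\<^esub> - \<parallel>x n i\<parallel>\<^bsub>X i\<^esub>\<bar> \<le> \<parallel>x m i \<ominus>\<^bsub>X i\<^esub> x n i\<parallel>\<^bsub>X i\<^esub>"
        using x i by (intro vnorm_reverse_triangle coord_closed)
      then show "\<bar>a m i - a n i\<bar> \<le> \<bar>(\<lambda>i\<in>I. \<parallel>(x m \<ominus>\<^bsub>S\<^esub> x n) i\<parallel>\<^bsub>X i\<^esub>) i\<bar>"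
        using i by (simp add: a_def sum_diff x)
    qed
    then show ?thesis by simp
  qed
  have "\<exists>M. \<forall>m\<ge>M. \<forall>n\<ge>M. N (\<lambda>i\<in>I. a m i - a n i) < \<epsilon>" if "\<epsilon> > 0" for \<epsilon>
    using Cauchy[OF that] a_diff le_less_trans by meson
  moreover have "(\<lambda>n. a n i) \<longlonglongrightarrow> \<parallel>z i\<parallel>\<^bsub>X i\<^esub>" if i: "i \<in> I" for i
  proof -
    interpret real_normed_space "X i" by (rule normed[OF i])
    have "norm (a n i - \<parallel>z i\<parallel>\<^bsub>X i\<^esub>) \<le> \<parallel>x n i \<ominus>\<^bsub>X i\<^esub> z i\<parallel>\<^bsub>X i\<^esub>" for n
      using vnorm_reverse_triangle[OF coord_closed[OF x i] z[OF i]] i by (simp add: a_def)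
    then show ?thesis
      by (intro LIM_zero_cancel[OF Lim_null_comparison[OF _ lim[OF i]]]) simp
  qed
  moreover have "a n \<in> E" for n unfolding a_def by (rule norms_E[OF x])
  ultimately have *: "(\<lambda>i\<in>I. \<parallel>z i\<parallel>\<^bsub>X i\<^esub>) \<in> E" "(\<lambda>n. N (a n)) \<longlonglongrightarrow> N (\<lambda>i\<in>I. \<parallel>z i\<parallel>\<^bsub>X i\<^esub>)"
    using Cauchy_coordinatewise_limit[of a "\<lambda>i. \<parallel>z i\<parallel>\<^bsub>X i\<^esub>"] by simp_all
  show "(\<lambda>i\<in>I. z i) \<in> carrier S"
    using * z by (simp add: carrier_sum_iff cong: restrict_cong)
  show "(\<lambda>n. \<parallel>x n\<parallel>\<^bsub>S\<^esub>) \<longlonglongrightarrow> \<parallel>\<lambda>i\<in>I. z i\<parallel>\<^bsub>S\<^esub>"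
    using *(2) by (simp add: a_def cong: restrict_cong)
qed

lemma banach_space_sum: "banach_space S"
proof (rule banach_spaceI[OF real_normed_space_sum])
  fix x :: "nat \<Rightarrow> 'i \<Rightarrow> 'a"
  assume x: "\<And>n. x n \<in> carrier S"
    and Cauchy: "\<And>\<epsilon>. \<epsilon> > 0 \<Longrightarrow> \<exists>M. \<forall>m\<ge>M. \<forall>n\<ge>M. \<parallel>x m \<ominus>\<^bsub>S\<^esub> x n\<parallel>\<^bsub>S\<^esub> < \<epsilon>"
  have "\<exists>z\<in>carrier (X i). (\<lambda>n. \<parallel>x n i \<ominus>\<^bsub>X i\<^esub> z\<parallel>\<^bsub>X i\<^esub>) \<longlonglongrightarrow> 0" if i: "i \<in> I" for i
  proof -
    have "\<parallel>x m i \<ominus>\<^bsub>X i\<^esub> x n i\<parallel>\<^bsub>X i\<^esub> \<le> \<parallel>x m \<ominus>\<^bsub>S\<^esub> x n\<parallel>\<^bsub>S\<^esub>" for m n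
      using coord_norm_le[OF sum_space.M.minus_closed[OF x x] i, of m n] i
      by (simp add: sum_diff[OF x x] del: sum_simps)
    then have "\<exists>M. \<forall>m\<ge>M. \<forall>n\<ge>M. \<parallel>x m i \<ominus>\<^bsub>X i\<^esub> x n i\<parallel>\<^bsub>X i\<^esub> < \<epsilon>" if "\<epsilon> > 0" for \<epsilon>
      using Cauchy[OF that] le_less_trans by meson
    then obtain z where "z \<in> carrier (X i)" "(\<lambda>n. \<parallel>x n i \<ominus>\<^bsub>X i\<^esub> z\<parallel>\<^bsub>X i\<^esub>) \<longlonglongrightarrow> 0"
      by (rule banach_space_complete[OF banach[OF i] coord_closed[OF x i]])
    then show ?thesis by blast
  qed
  then obtain z where z: "\<And>i. i \<in> I \<Longrightarrow> z i \<in> carrier (X i)"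
    and lim: "\<And>i. i \<in> I \<Longrightarrow> (\<lambda>n. \<parallel>x n i \<ominus>\<^bsub>X i\<^esub> z i\<parallel>\<^bsub>X i\<^esub>) \<longlonglongrightarrow> 0"
    by metis
  let ?z = "\<lambda>i\<in>I. z i"
  have zS: "?z \<in> carrier S"
    using Cauchy_coordinatewise_limit_sum(1)[OF x Cauchy z lim] .
  \<comment> \<open>The preceding lemma is applied to the sequence of differences from the fixed
    \<open>x k\<close>. Its coordinatewise limit is \<open>x k \<ominus> z\<close>, so letting n
    grow in the Cauchy estimate bounds the distance from \<open>x k\<close> to the candidate
    limit.\<close>
  have limS: "(\<lambda>n. \<parallel>x k \<ominus>\<^bsub>S\<^esub> x n\<parallel>\<^bsub>S\<^esub>) \<longlonglongrightarrow> \<parallel>x k \<ominus>\<^bsub>S\<^esub> ?z\<parallel>\<^bsub>S\<^esub>" for k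
  proof -
    have "(\<lambda>n. \<parallel>x k \<ominus>\<^bsub>S\<^esub> x n\<parallel>\<^bsub>S\<^esub>) \<longlonglongrightarrow> \<parallel>\<lambda>i\<in>I. x k i \<ominus>\<^bsub>X i\<^esub> z i\<parallel>\<^bsub>S\<^esub>"
    proof (rule Cauchy_coordinatewise_limit_sum(2))
      show "x k \<ominus>\<^bsub>S\<^esub> x n \<in> carrier S" for n using x by simp
      show "\<exists>M. \<forall>m\<ge>M. \<forall>n\<ge>M. \<parallel>(x k \<ominus>\<^bsub>S\<^esub> x m) \<ominus>\<^bsub>S\<^esub> (x k \<ominus>\<^bsub>S\<^esub> x n)\<parallel>\<^bsub>S\<^esub> < \<epsilon>" if "\<epsilon> > 0" for \<epsilon>
        using Cauchy[OF that] sum_space.vnorm_diff_diff[OF x x x, of k] by metis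
      fix i assume i: "i \<in> I"
      interpret real_normed_space "X i" by (rule normed[OF i])
      show "x k i \<ominus>\<^bsub>X i\<^esub> z i \<in> carrier (X i)"
        using coord_closed[OF x i] z[OF i] by simp
      show "(\<lambda>n. \<parallel>(x k \<ominus>\<^bsub>S\<^esub> x n) i \<ominus>\<^bsub>X i\<^esub> (x k i \<ominus>\<^bsub>X i\<^esub> z i)\<parallel>\<^bsub>X i\<^esub>) \<longlonglongrightarrow> 0"
        using lim[OF i] i vnorm_diff_diff[OF coord_closed[OF x i] coord_closed[OF x i] z[OF i]]
        by (simp add: sum_diff x)
    qed
    moreover have "(\<lambda>i\<in>I. x k i \<ominus>\<^bsub>X i\<^esub> z i) = x k \<ominus>\<^bsub>S\<^esub> ?z"
      using sum_diff[OF x zS] by (auto simp del: sum_simps)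
    ultimately show ?thesis by (simp only:)
  qed
  have "(\<lambda>n. \<parallel>x n \<ominus>\<^bsub>S\<^esub> ?z\<parallel>\<^bsub>S\<^esub>) \<longlonglongrightarrow> 0"
  proof (rule LIMSEQ_I)
    fix \<epsilon> :: real assume "\<epsilon> > 0"
    \<comment> \<open>Passing to the limit in n weakens \<open><\<close> to \<open>\<le>\<close>;
      the half restores strictness.\<close>
    then obtain M where M: "\<And>m n. m \<ge> M \<Longrightarrow> n \<ge> M \<Longrightarrow> \<parallel>x m \<ominus>\<^bsub>S\<^esub> x n\<parallel>\<^bsub>S\<^esub> < \<epsilon> / 2"
      using Cauchy[of "\<epsilon> / 2"] by auto
    have "norm (\<parallel>x k \<ominus>\<^bsub>S\<^esub> ?z\<parallel>\<^bsub>S\<^esub> - 0) < \<epsilon>" if "k \<ge> M" for k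
    proof -
      have "\<parallel>x k \<ominus>\<^bsub>S\<^esub> ?z\<parallel>\<^bsub>S\<^esub> \<le> \<epsilon> / 2"
        using M[OF that] less_imp_le by (intro LIMSEQ_le_const2[OF limS]) blast
      moreover have "0 \<le> \<parallel>x k \<ominus>\<^bsub>S\<^esub> ?z\<parallel>\<^bsub>S\<^esub>"
        using x zS by (intro sum_space.vnorm_nonneg sum_space.M.minus_closed)
      ultimately show ?thesis using \<open>\<epsilon> > 0\<close> by (simp del: sum_simps)
    qed
    then show "\<exists>M. \<forall>k\<ge>M. norm (\<parallel>x k \<ominus>\<^bsub>S\<^esub> ?z\<parallel>\<^bsub>S\<^esub> - 0) < \<epsilon>" by blast
  qed
  with zS show "\<exists>l\<in>carrier S. (\<lambda>n. \<parallel>x n \<ominus>\<^bsub>S\<^esub> l\<parallel>\<^bsub>S\<^esub>) \<longlonglongrightarrow> 0" by blast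
qed

section \<open>Coordinate embeddings and functionals on the sum\<close>

definition single :: "'i \<Rightarrow> 'a \<Rightarrow> 'i \<Rightarrow> 'a" where
  "single i v = (\<lambda>j\<in>I. if j = i then v else \<zero>\<^bsub>X j\<^esub>)"

text \<open>The norm family of \<open>single i v\<close> lies below a multiple of the
  \<open>i\<close>-th unit vector, which has norm 1. The inequality makes the canonical injection of
  \<open>X i\<close> bounded, as restricting functionals requires.\<close>

lemma single_in_sum:
  assumes i: "i \<in> I" and v: "v \<in> carrier (X i)"
  shows "single i v \<in> carrier S" "\<parallel>single i v\<parallel>\<^bsub>S\<^esub> \<le> \<parallel>v\<parallel>\<^bsub>X i\<^esub>"
proof -
  interpret real_normed_space "X i" by (rule normed[OF i])
  let ?a = "\<lambda>j\<in>I. \<parallel>v\<parallel>\<^bsub>X i\<^esub> * unit_vector I i j"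
  let ?v = "\<lambda>j. if j = i then v else \<zero>\<^bsub>X j\<^esub>"
  have aE: "?a \<in> E" by (rule E_scale[OF unit_vector_E[OF i]])
  have closed: "?v j \<in> carrier (X j)" if "j \<in> I" for j
    using that v zero_closed_X by simp
  have le: "\<parallel>?v j\<parallel>\<^bsub>X j\<^esub> \<le> ?a j" if "j \<in> I" for j
    using that real_normed_space.vnorm_zero[OF normed] by (simp add: unit_vector_def)
  note * = dominated_in_sum[OF aE closed le]
  show "single i v \<in> carrier S" unfolding single_def by (rule *(1))
  have "\<parallel>single i v\<parallel>\<^bsub>S\<^esub> = N (\<lambda>j\<in>I. \<parallel>?v j\<parallel>\<^bsub>X j\<^esub>)"
    by (simp add: single_def cong: restrict_cong)
  also have "\<dots> \<le> N ?a" by (rule *(2))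
  also have "N ?a = \<parallel>v\<parallel>\<^bsub>X i\<^esub>"
    using N_scale[OF unit_vector_E[OF i], of "\<parallel>v\<parallel>\<^bsub>X i\<^esub>"] i v by (simp add: N_unit_vector vnorm_nonneg)
  finally show "\<parallel>single i v\<parallel>\<^bsub>S\<^esub> \<le> \<parallel>v\<parallel>\<^bsub>X i\<^esub>" .
qed

lemma dual_single:
  assumes f: "f \<in> dual S" and i: "i \<in> I"
  shows "(\<lambda>v. f (single i v)) \<in> dual (X i)"
proof -
  interpret real_normed_space "X i" by (rule normed[OF i])
  from f obtain C where C: "\<And>x. x \<in> carrier S \<Longrightarrow> \<bar>f x\<bar> \<le> C * \<parallel>x\<parallel>\<^bsub>S\<^esub>"
    unfolding dual_def by blast
  have f_add: "f (x \<oplus>\<^bsub>S\<^esub> y) = f x + f y" if "x \<in> carrier S" "y \<in> carrier S" for x y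
    using f that unfolding dual_def by blast
  have f_smult: "f (c \<odot>\<^bsub>S\<^esub> x) = c * f x" if "x \<in> carrier S" for c x
    using f that unfolding dual_def by blast
  have "single i (u \<oplus>\<^bsub>X i\<^esub> v) = single i u \<oplus>\<^bsub>S\<^esub> single i v" for u v
    using abelian_monoid.l_zero[OF abelian_group.axioms(1)[OF abelian_group_X]] zero_closed_X
    by (auto simp: single_def)
  moreover have "single i (c \<odot>\<^bsub>X i\<^esub> v) = c \<odot>\<^bsub>S\<^esub> single i v" for c v
    using Module.module.smult_r_null[OF module_X] by (auto simp: single_def)
  \<comment> \<open>The constant supplied by \<open>dual\<close> may be negative, so enlarging the
    norm it multiplies requires its absolute value.\<close>
  moreover have "\<bar>f (single i v)\<bar> \<le> \<bar>C\<bar> * \<parallel>v\<parallel>\<^bsub>X i\<^esub>" if "v \<in> carrier (X i)" for v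
  proof -
    have "\<bar>f (single i v)\<bar> \<le> \<bar>C\<bar> * \<parallel>single i v\<parallel>\<^bsub>S\<^esub>"
      using C[OF single_in_sum(1)[OF i that]] sum_space.vnorm_nonneg[OF single_in_sum(1)[OF i that]]
      by (meson abs_ge_self mult_right_mono order_trans)
    also have "\<dots> \<le> \<bar>C\<bar> * \<parallel>v\<parallel>\<^bsub>X i\<^esub>"
      using single_in_sum(2)[OF i that] by (intro mult_left_mono) simp_all
    finally show ?thesis .
  qed
  ultimately show ?thesis
    unfolding dual_def using single_in_sum(1)[OF i]
    by (auto simp: f_add f_smult simp del: sum_simps intro!: exI[of _ "\<bar>C\<bar>"])
qed

text \<open>Counterpart for functionals of \<open>N_le_sum_plus_tail\<close>, by the same peeling of
  indices but with equality, because \<open>f\<close> is additive. The finite sum sees single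
  summands only, and the last term can be estimated through the bound on \<open>f\<close>.\<close>

lemma dual_eq_sum_plus_tail:
  assumes f: "f \<in> dual S" and x: "x \<in> carrier S" and "finite F" "F \<subseteq> I"
  shows "(\<lambda>i\<in>I. if i \<in> F then \<zero>\<^bsub>X i\<^esub> else x i) \<in> carrier S"
    and "f x = (\<Sum>i\<in>F. f (single i (x i))) + f (\<lambda>i\<in>I. if i \<in> F then \<zero>\<^bsub>X i\<^esub> else x i)"
proof -
  let ?t = "\<lambda>G. \<lambda>i\<in>I. if i \<in> G then \<zero>\<^bsub>X i\<^esub> else x i"
  have tS: "?t G \<in> carrier S" for G
    using real_normed_space.vnorm_nonneg[OF normed] real_normed_space.vnorm_zero[OF normed]
      coord_closed[OF x] zero_closed_X
    by (intro dominated_in_sum(1)[OF norms_E[OF x]]) auto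
  then show "?t F \<in> carrier S" .
  show "f x = (\<Sum>i\<in>F. f (single i (x i))) + f (?t F)"
    using assms(3,4)
  proof (induction F)
    case empty
    then show ?case using sum_restrict[OF x] by simp
  next
    case (insert j F)
    then have j: "j \<in> I" "j \<notin> F" by auto
    have l_zero: "\<zero>\<^bsub>X i\<^esub> \<oplus>\<^bsub>X i\<^esub> v = v" and r_zero: "v \<oplus>\<^bsub>X i\<^esub> \<zero>\<^bsub>X i\<^esub> = v"
      if "i \<in> I" "v \<in> carrier (X i)" for i v
      using that abelian_group.axioms(1)[OF abelian_group_X]
      by (simp_all add: abelian_monoid.l_zero abelian_monoid.r_zero)
    have "?t F = single j (x j) \<oplus>\<^bsub>S\<^esub> ?t (insert j F)"
      using j coord_closed[OF x] zero_closed_X by (auto simp: single_def l_zero r_zero)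
    moreover have "f (single j (x j) \<oplus>\<^bsub>S\<^esub> ?t (insert j F)) = f (single j (x j)) + f (?t (insert j F))"
      using f single_in_sum(1)[OF j(1) coord_closed[OF x j(1)]] tS[of "insert j F"]
      unfolding dual_def by blast
    ultimately have "f (?t F) = f (single j (x j)) + f (?t (insert j F))" by (simp only:)
    then show ?case using insert.IH insert.prems insert.hyps by (simp add: restrict_def)
  qed
qed

end

section \<open>Weakly null sequences and the WASQ property of the sum\<close>

locale order_continuous_banach_family =
  banach_family I E N X + order_continuous_absolute_normed_space I E N
  for I :: "'i set" and E N and X :: "'i \<Rightarrow> 'a normed_module"
begin

text \<open>Weak convergence in every coordinate does not suffice: in the space of absolutely
  summable sequences the unit vectors are coordinatewise null, yet the summation functional equals 1
  on each. Domination by \<open>x\<close> excludes such escape to infinity, since one finite set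
  works for all n.\<close>

lemma dominated_weakly_null:
  assumes x: "x \<in> carrier S"
    and bound: "\<And>i n. i \<in> I \<Longrightarrow> \<parallel>y n i\<parallel>\<^bsub>X i\<^esub> \<le> \<parallel>x i\<parallel>\<^bsub>X i\<^esub>"
    and weak: "\<And>i. i \<in> I \<Longrightarrow> weakly_convergent_to (X i) (\<lambda>n. y n i) \<zero>\<^bsub>X i\<^esub>"
  shows "weakly_convergent_to S (\<lambda>n. \<lambda>i\<in>I. y n i) \<zero>\<^bsub>S\<^esub>"
proof -
  have yX: "y n i \<in> carrier (X i)" if "i \<in> I" for n i
    using weak[OF that] by (auto simp: weakly_convergent_to_def)
  let ?y = "\<lambda>n. \<lambda>i\<in>I. y n i"
  have yS: "?y n \<in> carrier S" for n
    using yX bound by (intro dominated_in_sum(1)[OF norms_E[OF x]]) auto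
  show ?thesis
    unfolding weakly_convergent_to_def
  proof (intro conjI ballI)
    show "range ?y \<subseteq> carrier S" using yS by (auto simp del: sum_simps)
    show "\<zero>\<^bsub>S\<^esub> \<in> carrier S" by (rule sum_space.M.zero_closed)
    fix f assume f: "f \<in> dual S"
    from f obtain C where C: "\<And>x. x \<in> carrier S \<Longrightarrow> \<bar>f x\<bar> \<le> C * \<parallel>x\<parallel>\<^bsub>S\<^esub>"
      unfolding dual_def by blast
    have f0: "f \<zero>\<^bsub>S\<^esub> = 0" using C[OF sum_space.M.zero_closed] sum_space.vnorm_zero by (simp del: sum_simps)
    have "(\<lambda>n. f (?y n)) \<longlonglongrightarrow> 0"
    proof (rule tendstoI)
      fix \<epsilon> :: real assume \<epsilon>: "\<epsilon> > 0"
      \<comment> \<open>Dividing by \<open>\<bar>C\<bar> + 1\<close> instead of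
        \<open>\<bar>C\<bar>\<close> covers \<open>C = 0\<close> and makes the resulting bound on
        the tail strict.\<close>
      define \<delta> where "\<delta> = \<epsilon> / 2 / (\<bar>C\<bar> + 1)"
      have \<delta>: "\<delta> > 0" using \<epsilon> by (simp add: \<delta>_def)
      have "\<bar>C\<bar> * \<delta> < (\<bar>C\<bar> + 1) * \<delta>" using \<delta> by (simp add: distrib_right)
      also have "\<dots> = \<epsilon> / 2"
      proof -
        have "\<bar>C\<bar> + 1 \<noteq> 0" using abs_ge_zero[of C] by linarith
        then show ?thesis
          unfolding \<delta>_def by (metis nonzero_mult_div_cancel_left times_divide_eq_right)
      qed
      finally have C\<delta>: "\<bar>C\<bar> * \<delta> < \<epsilon> / 2" .
      \<comment> \<open>The set is chosen from \<open>x\<close> before any n is fixed, hence the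
        tail estimate below is uniform in n.\<close>
      obtain F where F: "finite F" "F \<subseteq> I"
        and tail: "N (\<lambda>i\<in>I. if i \<in> F then 0 else (\<lambda>i\<in>I. \<parallel>x i\<parallel>\<^bsub>X i\<^esub>) i) < \<delta>"
        using small_tail[OF norms_E[OF x] \<delta>] by blast
      let ?t = "\<lambda>n. \<lambda>i\<in>I. if i \<in> F then \<zero>\<^bsub>X i\<^esub> else ?y n i"
      note split = dual_eq_sum_plus_tail[OF f yS F]
      have tail_f: "\<bar>f (?t n)\<bar> < \<epsilon> / 2" for n
      proof -
        have "\<parallel>?t n\<parallel>\<^bsub>S\<^esub> \<le> N (\<lambda>i\<in>I. if i \<in> F then 0 else (\<lambda>i\<in>I. \<parallel>x i\<parallel>\<^bsub>X i\<^esub>) i)"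
          unfolding sum_simps
        proof (rule ideal(2))
          show "(\<lambda>i\<in>I. if i \<in> F then 0 else (\<lambda>i\<in>I. \<parallel>x i\<parallel>\<^bsub>X i\<^esub>) i) \<in> E"
            by (rule ideal(1)[OF norms_E[OF x]]) auto
          fix i assume i: "i \<in> I"
          interpret real_normed_space "X i" by (rule normed[OF i])
          show "\<bar>\<parallel>?t n i\<parallel>\<^bsub>X i\<^esub>\<bar> \<le> \<bar>(\<lambda>i\<in>I. if i \<in> F then 0 else (\<lambda>i\<in>I. \<parallel>x i\<parallel>\<^bsub>X i\<^esub>) i) i\<bar>"
            using bound[OF i, of n] vnorm_nonneg[OF yX[OF i, of n]] i by simp
        qed
        from order.strict_implies_order[OF le_less_trans[OF this tail]]
        have "\<bar>C\<bar> * \<parallel>?t n\<parallel>\<^bsub>S\<^esub> \<le> \<bar>C\<bar> * \<delta>" by (rule mult_left_mono) (rule abs_ge_zero)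
        moreover have "C * \<parallel>?t n\<parallel>\<^bsub>S\<^esub> \<le> \<bar>C\<bar> * \<parallel>?t n\<parallel>\<^bsub>S\<^esub>"
          by (rule mult_right_mono[OF abs_ge_self sum_space.vnorm_nonneg[OF split(1)]])
        ultimately show ?thesis using C[OF split(1), of n] C\<delta> by (meson le_less_trans order_trans)
      qed
      have "(\<lambda>n. f (single i (?y n i))) \<longlonglongrightarrow> 0" if "i \<in> F" for i
      proof -
        have i: "i \<in> I" using that F by blast
        have "single i \<zero>\<^bsub>X i\<^esub> = \<zero>\<^bsub>S\<^esub>" by (auto simp: single_def)
        \<comment> \<open>Weak convergence in \<open>X i\<close> is tested against the restriction
          of \<open>f\<close> along \<open>single i\<close>.\<close>
        moreover have "\<forall>g\<in>dual (X i). (\<lambda>n. g (y n i)) \<longlonglongrightarrow> g \<zero>\<^bsub>X i\<^esub>"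
          using weak[OF i] by (simp add: weakly_convergent_to_def)
        from bspec[OF this dual_single[OF f i]]
        have "(\<lambda>n. f (single i (y n i))) \<longlonglongrightarrow> f (single i \<zero>\<^bsub>X i\<^esub>)" .
        ultimately show ?thesis by (simp only: f0 restrict_apply'[OF i])
      qed
      then have "(\<lambda>n. \<Sum>i\<in>F. f (single i (?y n i))) \<longlonglongrightarrow> 0"
        by (rule tendsto_null_sum)
      then have "\<forall>\<^sub>F n in sequentially. dist (\<Sum>i\<in>F. f (single i (?y n i))) 0 < \<epsilon> / 2"
        using \<epsilon> by (intro tendstoD) simp_all
      then show "\<forall>\<^sub>F n in sequentially. dist (f (?y n)) 0 < \<epsilon>"
      proof eventually_elim
        case (elim n)
        have "\<bar>f (?y n)\<bar> \<le> \<bar>\<Sum>i\<in>F. f (single i (?y n i))\<bar> + \<bar>f (?t n)\<bar>"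
          unfolding split(2)[of n] by (rule abs_triangle_ineq)
        also have "\<dots> < \<epsilon> / 2 + \<epsilon> / 2"
          using elim tail_f[of n] unfolding dist_real_def diff_0_right by (rule add_strict_mono)
        finally show ?case by (simp only: dist_real_def diff_0_right field_sum_of_halves)
      qed
    qed
    then show "(\<lambda>n. f (?y n)) \<longlonglongrightarrow> f \<zero>\<^bsub>S\<^esub>" unfolding f0 .
  qed
qed

lemma WASQ_sum:
  assumes WASQ: "\<And>i. i \<in> I \<Longrightarrow> WASQ (X i)"
  shows "WASQ S"
  unfolding WASQ_def
proof (intro conjI ballI banach_space_sum)
  fix x assume "x \<in> unit_sphere S"
  then have x: "x \<in> carrier S" and norm_x: "\<parallel>x\<parallel>\<^bsub>S\<^esub> = 1"
    by (simp_all add: unit_sphere_def)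
  note xi = coord_closed[OF x]
  have "\<forall>i\<in>I. \<exists>z. (\<forall>n. z n \<in> carrier (X i) \<and> \<parallel>z n\<parallel>\<^bsub>X i\<^esub> \<le> \<parallel>x i\<parallel>\<^bsub>X i\<^esub>) \<and>
      (\<lambda>n. \<parallel>x i \<oplus>\<^bsub>X i\<^esub> z n\<parallel>\<^bsub>X i\<^esub>) \<longlonglongrightarrow> \<parallel>x i\<parallel>\<^bsub>X i\<^esub> \<and>
      (\<lambda>n. \<parallel>x i \<ominus>\<^bsub>X i\<^esub> z n\<parallel>\<^bsub>X i\<^esub>) \<longlonglongrightarrow> \<parallel>x i\<parallel>\<^bsub>X i\<^esub> \<and>
      (\<lambda>n. \<parallel>z n\<parallel>\<^bsub>X i\<^esub>) \<longlonglongrightarrow> \<parallel>x i\<parallel>\<^bsub>X i\<^esub> \<and> weakly_convergent_to (X i) z \<zero>\<^bsub>X i\<^esub>"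
    by (intro ballI WASQ_scaled WASQ xi)
  from bchoice[OF this] obtain z where
    "\<forall>i\<in>I. (\<forall>n. z i n \<in> carrier (X i) \<and> \<parallel>z i n\<parallel>\<^bsub>X i\<^esub> \<le> \<parallel>x i\<parallel>\<^bsub>X i\<^esub>) \<and>
      (\<lambda>n. \<parallel>x i \<oplus>\<^bsub>X i\<^esub> z i n\<parallel>\<^bsub>X i\<^esub>) \<longlonglongrightarrow> \<parallel>x i\<parallel>\<^bsub>X i\<^esub> \<and>
      (\<lambda>n. \<parallel>x i \<ominus>\<^bsub>X i\<^esub> z i n\<parallel>\<^bsub>X i\<^esub>) \<longlonglongrightarrow> \<parallel>x i\<parallel>\<^bsub>X i\<^esub> \<and>
      (\<lambda>n. \<parallel>z i n\<parallel>\<^bsub>X i\<^esub>) \<longlonglongrightarrow> \<parallel>x i\<parallel>\<^bsub>X i\<^esub> \<and> weakly_convergent_to (X i) (z i) \<zero>\<^bsub>X i\<^esub>" ..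
  then have z: "\<And>i n. i \<in> I \<Longrightarrow> z i n \<in> carrier (X i)"
      "\<And>i n. i \<in> I \<Longrightarrow> \<parallel>z i n\<parallel>\<^bsub>X i\<^esub> \<le> \<parallel>x i\<parallel>\<^bsub>X i\<^esub>"
    and lims: "\<And>i. i \<in> I \<Longrightarrow> (\<lambda>n. \<parallel>x i \<oplus>\<^bsub>X i\<^esub> z i n\<parallel>\<^bsub>X i\<^esub>) \<longlonglongrightarrow> \<parallel>x i\<parallel>\<^bsub>X i\<^esub>"
      "\<And>i. i \<in> I \<Longrightarrow> (\<lambda>n. \<parallel>x i \<ominus>\<^bsub>X i\<^esub> z i n\<parallel>\<^bsub>X i\<^esub>) \<longlonglongrightarrow> \<parallel>x i\<parallel>\<^bsub>X i\<^esub>"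
      "\<And>i. i \<in> I \<Longrightarrow> (\<lambda>n. \<parallel>z i n\<parallel>\<^bsub>X i\<^esub>) \<longlonglongrightarrow> \<parallel>x i\<parallel>\<^bsub>X i\<^esub>"
    and weak: "\<And>i. i \<in> I \<Longrightarrow> weakly_convergent_to (X i) (z i) \<zero>\<^bsub>X i\<^esub>"
    by simp_all
  define y where "y n = (\<lambda>i\<in>I. z i n)" for n
  \<comment> \<open>The scaled sequences never exceed \<open>x i\<close> in norm, so
    \<open>y n\<close> is dominated by the unit vector \<open>x\<close> and lies in the unit ball
    without renormalisation.\<close>
  have y: "y n \<in> carrier S" and "\<parallel>y n\<parallel>\<^bsub>S\<^esub> \<le> 1" for n
  proof -
    have "\<parallel>z i n\<parallel>\<^bsub>X i\<^esub> \<le> (\<lambda>i\<in>I. \<parallel>x i\<parallel>\<^bsub>X i\<^esub>) i" if "i \<in> I" for i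
      using z(2)[OF that] that by simp
    note * = dominated_in_sum[OF norms_E[OF x] z(1) this]
    show "y n \<in> carrier S" unfolding y_def by (rule *(1))
    have "(\<lambda>i\<in>I. \<parallel>y n i\<parallel>\<^bsub>X i\<^esub>) = (\<lambda>i\<in>I. \<parallel>z i n\<parallel>\<^bsub>X i\<^esub>)" by (auto simp: y_def)
    then show "\<parallel>y n\<parallel>\<^bsub>S\<^esub> \<le> 1" using *(2) norm_x unfolding sum_simps by (simp only:)
  qed
  then have "\<forall>n. y n \<in> unit_ball S" by (simp add: unit_ball_def del: sum_simps)
  \<comment> \<open>A single statement for the three norm limits, with \<open>w n\<close> in turn
    the sum and the difference of \<open>x\<close> and \<open>y n\<close>, and \<open>y n\<close>
    itself: in each case the coordinate norms tend to those of \<open>x\<close>, whose norm family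
    has norm 1. Nonnegativity is a premise because \<open>w\<close> ranges over arbitrary
    families.\<close>
  have conv: "(\<lambda>n. \<parallel>w n\<parallel>\<^bsub>S\<^esub>) \<longlonglongrightarrow> 1"
    if w: "\<And>n i. i \<in> I \<Longrightarrow> 0 \<le> \<parallel>w n i\<parallel>\<^bsub>X i\<^esub>"
      "\<And>n i. i \<in> I \<Longrightarrow> \<parallel>w n i\<parallel>\<^bsub>X i\<^esub> \<le> \<parallel>x i\<parallel>\<^bsub>X i\<^esub> + \<parallel>z i n\<parallel>\<^bsub>X i\<^esub>"
      "\<And>i. i \<in> I \<Longrightarrow> (\<lambda>n. \<parallel>w n i\<parallel>\<^bsub>X i\<^esub>) \<longlonglongrightarrow> \<parallel>x i\<parallel>\<^bsub>X i\<^esub>" for w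
  proof -
    have "(\<lambda>n. N (\<lambda>i\<in>I. \<parallel>w n i\<parallel>\<^bsub>X i\<^esub>)) \<longlonglongrightarrow> N (\<lambda>i\<in>I. \<parallel>x i\<parallel>\<^bsub>X i\<^esub>)"
    proof (rule dominated_convergence[OF E_scale[OF norms_E[OF x], of 2]])
      fix n i assume i: "i \<in> I"
      show "\<bar>\<parallel>w n i\<parallel>\<^bsub>X i\<^esub>\<bar> \<le> (\<lambda>i\<in>I. 2 * (\<lambda>i\<in>I. \<parallel>x i\<parallel>\<^bsub>X i\<^esub>) i) i"
        using w(1,2)[OF i, of n] z(2)[OF i, of n] i by simp
    qed (rule w(3))
    then show ?thesis using norm_x by simp
  qed
  have nonneg: "0 \<le> \<parallel>v\<parallel>\<^bsub>X i\<^esub>" if "i \<in> I" "v \<in> carrier (X i)" for i v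
    using real_normed_space.vnorm_nonneg[OF normed] that by blast
  have closed: "x i \<oplus>\<^bsub>X i\<^esub> z i n \<in> carrier (X i)" "x i \<ominus>\<^bsub>X i\<^esub> z i n \<in> carrier (X i)"
    and triangle: "\<parallel>x i \<oplus>\<^bsub>X i\<^esub> z i n\<parallel>\<^bsub>X i\<^esub> \<le> \<parallel>x i\<parallel>\<^bsub>X i\<^esub> + \<parallel>z i n\<parallel>\<^bsub>X i\<^esub>"
      "\<parallel>x i \<ominus>\<^bsub>X i\<^esub> z i n\<parallel>\<^bsub>X i\<^esub> \<le> \<parallel>x i\<parallel>\<^bsub>X i\<^esub> + \<parallel>z i n\<parallel>\<^bsub>X i\<^esub>"
    if i: "i \<in> I" for i n
  proof -
    interpret real_normed_space "X i" by (rule normed[OF i])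
    show "x i \<oplus>\<^bsub>X i\<^esub> z i n \<in> carrier (X i)" "x i \<ominus>\<^bsub>X i\<^esub> z i n \<in> carrier (X i)"
      "\<parallel>x i \<oplus>\<^bsub>X i\<^esub> z i n\<parallel>\<^bsub>X i\<^esub> \<le> \<parallel>x i\<parallel>\<^bsub>X i\<^esub> + \<parallel>z i n\<parallel>\<^bsub>X i\<^esub>"
      "\<parallel>x i \<ominus>\<^bsub>X i\<^esub> z i n\<parallel>\<^bsub>X i\<^esub> \<le> \<parallel>x i\<parallel>\<^bsub>X i\<^esub> + \<parallel>z i n\<parallel>\<^bsub>X i\<^esub>"
      using xi[OF i] z(1)[OF i] by (simp_all add: vnorm_triangle vnorm_triangle_minus)
  qed
  show "\<exists>y. (\<forall>n. y n \<in> unit_ball S) \<and> (\<lambda>n. \<parallel>x \<oplus>\<^bsub>S\<^esub> y n\<parallel>\<^bsub>S\<^esub>) \<longlonglongrightarrow> 1 \<and>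
      (\<lambda>n. \<parallel>x \<ominus>\<^bsub>S\<^esub> y n\<parallel>\<^bsub>S\<^esub>) \<longlonglongrightarrow> 1 \<and> (\<lambda>n. \<parallel>y n\<parallel>\<^bsub>S\<^esub>) \<longlonglongrightarrow> 1 \<and>
      weakly_convergent_to S y \<zero>\<^bsub>S\<^esub>"
  proof (intro exI[of _ y] conjI)
    show "\<forall>n. y n \<in> unit_ball S" by fact
    show "(\<lambda>n. \<parallel>x \<oplus>\<^bsub>S\<^esub> y n\<parallel>\<^bsub>S\<^esub>) \<longlonglongrightarrow> 1"
      by (rule conv) (simp_all add: y_def nonneg closed triangle lims)
    show "(\<lambda>n. \<parallel>x \<ominus>\<^bsub>S\<^esub> y n\<parallel>\<^bsub>S\<^esub>) \<longlonglongrightarrow> 1"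
      unfolding sum_diff[OF x y]
      by (rule conv) (simp_all add: y_def nonneg closed triangle lims)
    show "(\<lambda>n. \<parallel>y n\<parallel>\<^bsub>S\<^esub>) \<longlonglongrightarrow> 1"
      by (rule conv) (simp_all add: y_def nonneg xi z(1) lims)
    show "weakly_convergent_to S y \<zero>\<^bsub>S\<^esub>"
      unfolding y_def by (rule dominated_weakly_null[OF x z(2) weak])
  qed
qed

end

theorem proposition5p2:
  fixes I :: "'i set"
    and E :: "('i \<Rightarrow> real) set"
    and N :: "('i \<Rightarrow> real) \<Rightarrow> real"
    and X :: "'i \<Rightarrow> 'a normed_module"
  assumes "I \<noteq> {}"
    and "submodule E real_ring (real_functions I)"
    and "absolute_norm I E N"
    and "norm_topology (function_space I E N) closure_of
           linear_span (function_space I E N) (unit_vector I ` I) = E"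
    and "\<And>i. i \<in> I \<Longrightarrow> WASQ (X i)"
  shows "WASQ (absolute_sum I E N X)"
proof -
  interpret absolute_normed_space I E N
    by unfold_locales (rule assms(3))
  interpret order_continuous_absolute_normed_space I E N
    by (rule dense_span_imp_order_continuous[OF assms(4)])
  interpret order_continuous_banach_family I E N X
    using assms(5) by unfold_locales (simp add: WASQ_def)
  show ?thesis
    by (rule WASQ_sum[OF assms(5)])
qed

end
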